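(* Let $\mathcal T=(\mathcal S,\to)$ be an LTS over $\Sigma$ and $\mathcal V$ a valuation, and let $S\subseteq\mathcal S$ and a well-formed formula $\Phi$ in positive normal form be such that $S\subseteq[\![\Phi]\!]_{\mathcal V}$. Then the sequent $S\vdash^{\mathcal T}_{\mathcal V,\varepsilon}\Phi$ (with empty definition list $\varepsilon$) has a successful tableau, i.e. there is a successful tableau whose root is labelled by this sequent.
   Context: Fix a set $\Sigma$ and a countably infinite set $\mathrm{Var}$ of propositional variables. An LTS is $\mathcal T=(\mathcal S,\to)$ with ${\to}\subseteq\mathcal S\times\Sigma\times\mathcal S$; for $K\subseteq\Sigma$ write $s\xrightarrow{K}s'$ if $s\xrightarrow{a}s'$ for some $a\in K$. A valuation is $\mathcal V:\mathrm{Var}\to 2^{\mathcal S}$. Formulas: $\Phi::=Z\mid\neg\Phi\mid\Phi_1\wedge\Phi_2\mid[K]\Phi\mid\nu Z.\Phi$, well-formed if in each subformula $\nu Z.\Phi$ every free occurrence of $Z$ in $\Phi$ is under an even number of negations. Derived: $\Phi_1\vee\Phi_2=\neg(\neg\Phi_1\wedge\neg\Phi_2)$, $\langle K\rangle\Phi=\neg[K]\neg\Phi$, $\mu Z.\Phi=\neg\nu Z.\neg\Phi[Z:=\neg Z]$. Semantics: $[\![Z]\!]_{\mathcal V}=\mathcal V(Z)$, negation is complement, $\wedge$ is intersection, $[\![[K]\Phi]\!]_{\mathcal V}=\{s\mid\forall s'.\ s\xrightarrow{K}s'\Rightarrow s'\in[\![\Phi]\!]_{\mathcal V}\}$, $[\![\nu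 Z.\Phi]\!]_{\mathcal V}=\bigcup\{S'\mid S'\subseteq[\![\Phi]\!]_{\mathcal V[Z:=S']}\}$. Positive normal form: built from $Z,\neg Z,\wedge,\vee,[K],\langle K\rangle,\nu,\mu$. Substitution is capture-free. Definition list: $\Delta=(U_1=\Phi_1)\cdots(U_n=\Phi_n)$, distinct $U_i\in\mathrm{Var}$, no $U_i$ bound in any $\Phi_j$, $U_j$ not free in $\Phi_i$ for $i\le j$; $\Delta(U_i)=\Phi_i$, $\mathrm{dom}(\Delta)=\{U_i\}$. $\mathcal V[\varepsilon]=\mathcal V$, $\mathcal V[(U=\Phi)\cdot\Delta]=(\mathcal V[U:=[\![\Phi]\!]_{\mathcal V}])[\Delta]$. A sequent $S\vdash^{\mathcal T}_{\mathcal V,\Delta}\Phi$: $S\subseteq\mathcal S$, $\Delta$ a definition list, $\Phi$ in positive normal form with every $U\in\mathrm{dom}(\Delta)$ positive and not bound in $\Phi$. Rules (conclusion; premises): ($\wedge$) $S\vdash_\Delta\Phi_1\wedge\Phi_2$; $S\vdash_\Delta\Phi_1$, $S\vdash_\Delta\Phi_2$. ($\vee$) $S\vdash_\Delta\Phi_1\vee\Phi_2$; $S_1\vdash_\Delta\Phi_1$, $S_2\vdash_\Delta\Phi_2$, $S=S_1\cup S_2$. ($[K]$) $S\vdash_\Delta[K]\Phi$; $\{s'\mid\exists s\in S.\ s\xrightarrow{K}s'\}\vdash_\Delta\Phi$. ($\langle K\rangle$ with witness $f:S\to\mathcal S$, $s\xrightarrow{K}f(s)$ for all $s\in S$) $S\vdash_\Delta\langle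 K\rangle\Phi$; $f(S)\vdash_\Delta\Phi$. ($\sigma Z$) $S\vdash_\Delta\sigma Z.\Phi$; $S\vdash_{\Delta\cdot(U=\sigma Z.\Phi)}U$, $U$ fresh. (Un) $S\vdash_\Delta U$; $S\vdash_\Delta\Phi[Z:=U]$ where $\Delta(U)=\sigma Z.\Phi$. (Thin) $S\vdash_\Delta\Phi$; $S'\vdash_\Delta\Phi$, $S\subseteq S'$. A partial tableau is a finite nonempty ordered tree of nodes labelled by sequents over $\mathcal T,\mathcal V$, each internal node labelled by a rule application (rule name, plus witness function for $\langle K\rangle$) such that it and its ordered children form an instance of the rule. Write $S_n$ for the state set of node $n$. It is a tableau if the root's definition list is empty and every leaf $n$ (sequent $S_n\vdash_\Delta\Phi$) is terminal: (a) $\Phi$ is $Z$ or $\neg Z$ with $Z\notin\mathrm{dom}(\Delta)$; or (b) $\Phi=\langle K\rangle\Psi$ and some $s\in S_n$ has no $K$-successor (diamond leaf); or (c) $\Phi=U\in\mathrm{dom}(\Delta)$ and some strict ancestor $m$ has formula $U$ and $S_n\subseteq S_m$ ($\sigma$-leaf; $\mu$-/$\nu$-leaf according to $\Delta(U)$). Companion nodes are the nodes with rule Un. Companion leaves of a companion node $m$: leaves that are strict descendants of $m$ with the same formula and $S_n\subseteq S_m$, excluding companion leaves of companion nodes strictly below $m$. For a child $n'$ of $n$: $s'<_{n',n}s$ iff $s'\in S_{n'}$, $s\in S_n$, and: rule $[K]$ with $s\xrightarrow{K}s'$; or rule $(\langle K\rangle,f)$ with $s'=f(s)$; or another rule with $s'=s$.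 $\lessdot_{n',n}$ is least with $s\lessdot_{n,n}s$ ($s\in S_n$) and: $s'\lessdot_{n',m}s''$, $s''<_{m,n}s$ imply $s'\lessdot_{n',n}s$. $<:_{n',n}$ and $<:_m$ ($m$ a companion node) are least with: $s'<:_m s$ iff some companion leaf $m'$ of $m$ has $s'\in S_{m'}$ and $s'<:_{m',m}s$; $s'<:_{n',n}s$ iff $s'\in S_{n'}$, $s\in S_n$, and either $s'\lessdot_{n',n}s$ or there are a companion node $m\notin\{n,n'\}$ and $t,t'\in S_m$ with $s'<:_{n',m}t'$, $t'(<:_m)^+t$, $t\lessdot_{m,n}s$. A leaf with sequent $S_n\vdash_\Delta\Phi$ is successful iff: $\Phi=Z\notin\mathrm{dom}(\Delta)$ and $S_n\subseteq\mathcal V(Z)$; or $\Phi=\neg Z$, $Z\notin\mathrm{dom}(\Delta)$, $S_n\cap\mathcal V(Z)=\emptyset$; or it is a $\nu$-leaf; or it is a $\mu$-leaf whose companion node $m$ has $<:_m$ well-founded. A tableau is successful iff all leaves are successful. *)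

theory Defs
  imports Main
begin

text \<open>An LTS over the action set \<Sigma> = UNIV :: 'a set with state set \<S> = UNIV :: 's set
  is given by its transition relation.  Propositional variables are natural numbers
  (a countably infinite set).\<close>

type_synonym ('s,'a) lts = "('s \<times> 'a \<times> 's) set"
type_synonym var = nat
type_synonym 's valuation = "var \<Rightarrow> 's set"

definition kstep :: "('s,'a) lts \<Rightarrow> 's \<Rightarrow> 'a set \<Rightarrow> 's \<Rightarrow> bool" where
  "kstep T s K s' \<longleftrightarrow> (\<exists>a\<in>K. (s, a, s') \<in> T)"

datatype 'a form =
    Var var
  | Neg "'a form"
  | And "'a form" "'a form"
  | Box "'a set" "'a form"
  | Nu var "'a form"

primrec sem :: "('s,'a) lts \<Rightarrow> 's valuation \<Rightarrow> 'a form \<Rightarrow> 's set" where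
  "sem T V (Var Z) = V Z"
| "sem T V (Neg \<phi>) = - sem T V \<phi>"
| "sem T V (And \<phi> \<psi>) = sem T V \<phi> \<inter> sem T V \<psi>"
| "sem T V (Box K \<phi>) = {s. \<forall>s'. kstep T s K s' \<longrightarrow> s' \<in> sem T V \<phi>}"
| "sem T V (Nu Z \<phi>) = \<Union>{S'. S' \<subseteq> sem T (V(Z := S')) \<phi>}"

text \<open>oddfree Z p \<phi>: some free occurrence of Z in \<phi> lies under an odd number of
  negations, where p records whether an odd number of negations has been passed.\<close>
primrec oddfree :: "var \<Rightarrow> bool \<Rightarrow> 'a form \<Rightarrow> bool" where
  "oddfree Z p (Var Y) = (Y = Z \<and> p)"
| "oddfree Z p (Neg \<phi>) = oddfree Z (\<not> p) \<phi>"
| "oddfree Z p (And \<phi> \<psi>) = (oddfree Z p \<phi> \<or> oddfree Z p \<psi>)"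
| "oddfree Z p (Box K \<phi>) = oddfree Z p \<phi>"
| "oddfree Z p (Nu Y \<phi>) = (Y \<noteq> Z \<and> oddfree Z p \<phi>)"

primrec wf_form :: "'a form \<Rightarrow> bool" where
  "wf_form (Var Y) = True"
| "wf_form (Neg \<phi>) = wf_form \<phi>"
| "wf_form (And \<phi> \<psi>) = (wf_form \<phi> \<and> wf_form \<psi>)"
| "wf_form (Box K \<phi>) = wf_form \<phi>"
| "wf_form (Nu Z \<phi>) = (\<not> oddfree Z False \<phi> \<and> wf_form \<phi>)"

text \<open>Capture-free substitution \<phi>[Z := \<not>Z] (the substituted term only contains Z,
  so no capture can occur).\<close>
primrec negvar :: "var \<Rightarrow> 'a form \<Rightarrow> 'a form" where
  "negvar Z (Var Y) = (if Y = Z then Neg (Var Z) else Var Y)"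
| "negvar Z (Neg \<phi>) = Neg (negvar Z \<phi>)"
| "negvar Z (And \<phi> \<psi>) = And (negvar Z \<phi>) (negvar Z \<psi>)"
| "negvar Z (Box K \<phi>) = Box K (negvar Z \<phi>)"
| "negvar Z (Nu Y \<phi>) = (if Y = Z then Nu Y \<phi> else Nu Y (negvar Z \<phi>))"

datatype 'a pform =
    PVar var
  | PNVar var
  | PAnd "'a pform" "'a pform"
  | POr "'a pform" "'a pform"
  | PBox "'a set" "'a pform"
  | PDia "'a set" "'a pform"
  | PNu var "'a pform"
  | PMu var "'a pform"

primrec to_core :: "'a pform \<Rightarrow> 'a form" where
  "to_core (PVar Z) = Var Z"
| "to_core (PNVar Z) = Neg (Var Z)"
| "to_core (PAnd \<phi> \<psi>) = And (to_core \<phi>) (to_core \<psi>)"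
| "to_core (POr \<phi> \<psi>) = Neg (And (Neg (to_core \<phi>)) (Neg (to_core \<psi>)))"
| "to_core (PBox K \<phi>) = Box K (to_core \<phi>)"
| "to_core (PDia K \<phi>) = Neg (Box K (Neg (to_core \<phi>)))"
| "to_core (PNu Z \<phi>) = Nu Z (to_core \<phi>)"
| "to_core (PMu Z \<phi>) = Neg (Nu Z (Neg (negvar Z (to_core \<phi>))))"

definition psem :: "('s,'a) lts \<Rightarrow> 's valuation \<Rightarrow> 'a pform \<Rightarrow> 's set" where
  "psem T V \<phi> = sem T V (to_core \<phi>)"

primrec fv :: "'a pform \<Rightarrow> var set" where
  "fv (PVar Z) = {Z}"
| "fv (PNVar Z) = {Z}"
| "fv (PAnd \<phi> \<psi>) = fv \<phi> \<union> fv \<psi>"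
| "fv (POr \<phi> \<psi>) = fv \<phi> \<union> fv \<psi>"
| "fv (PBox K \<phi>) = fv \<phi>"
| "fv (PDia K \<phi>) = fv \<phi>"
| "fv (PNu Z \<phi>) = fv \<phi> - {Z}"
| "fv (PMu Z \<phi>) = fv \<phi> - {Z}"

primrec bv :: "'a pform \<Rightarrow> var set" where
  "bv (PVar Z) = {}"
| "bv (PNVar Z) = {}"
| "bv (PAnd \<phi> \<psi>) = bv \<phi> \<union> bv \<psi>"
| "bv (POr \<phi> \<psi>) = bv \<phi> \<union> bv \<psi>"
| "bv (PBox K \<phi>) = bv \<phi>"
| "bv (PDia K \<phi>) = bv \<phi>"
| "bv (PNu Z \<phi>) = insert Z (bv \<phi>)"
| "bv (PMu Z \<phi>) = insert Z (bv \<phi>)"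

primrec allv :: "'a pform \<Rightarrow> var set" where
  "allv (PVar Z) = {Z}"
| "allv (PNVar Z) = {Z}"
| "allv (PAnd \<phi> \<psi>) = allv \<phi> \<union> allv \<psi>"
| "allv (POr \<phi> \<psi>) = allv \<phi> \<union> allv \<psi>"
| "allv (PBox K \<phi>) = allv \<phi>"
| "allv (PDia K \<phi>) = allv \<phi>"
| "allv (PNu Z \<phi>) = insert Z (allv \<phi>)"
| "allv (PMu Z \<phi>) = insert Z (allv \<phi>)"

text \<open>Substitution \<Phi>[Z := U] of a variable for a variable (capture-free in all
  uses below, since definition-list variables are never bound).\<close>
primrec psubst :: "var \<Rightarrow> var \<Rightarrow> 'a pform \<Rightarrow> 'a pform" where
  "psubst Z U (PVar Y) = PVar (if Y = Z then U else Y)"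
| "psubst Z U (PNVar Y) = PNVar (if Y = Z then U else Y)"
| "psubst Z U (PAnd \<phi> \<psi>) = PAnd (psubst Z U \<phi>) (psubst Z U \<psi>)"
| "psubst Z U (POr \<phi> \<psi>) = POr (psubst Z U \<phi>) (psubst Z U \<psi>)"
| "psubst Z U (PBox K \<phi>) = PBox K (psubst Z U \<phi>)"
| "psubst Z U (PDia K \<phi>) = PDia K (psubst Z U \<phi>)"
| "psubst Z U (PNu Y \<phi>) = (if Y = Z then PNu Y \<phi> else PNu Y (psubst Z U \<phi>))"
| "psubst Z U (PMu Y \<phi>) = (if Y = Z then PMu Y \<phi> else PMu Y (psubst Z U \<phi>))"

definition positive_in :: "var \<Rightarrow> 'a pform \<Rightarrow> bool" where
  "positive_in U \<phi> \<longleftrightarrow> \<not> oddfree U False (to_core \<phi>)"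

type_synonym 'a deflist = "(var \<times> 'a pform) list"

definition ddom :: "'a deflist \<Rightarrow> var set" where
  "ddom \<Delta> = fst ` set \<Delta>"

definition is_deflist :: "'a deflist \<Rightarrow> bool" where
  "is_deflist \<Delta> \<longleftrightarrow>
     distinct (map fst \<Delta>)
   \<and> (\<forall>i < length \<Delta>. \<forall>j < length \<Delta>. fst (\<Delta> ! i) \<notin> bv (snd (\<Delta> ! j)))
   \<and> (\<forall>i < length \<Delta>. \<forall>j < length \<Delta>. i \<le> j \<longrightarrow> fst (\<Delta> ! j) \<notin> fv (snd (\<Delta> ! i)))"

type_synonym ('s,'a) seq = "'s set \<times> 'a deflist \<times> 'a pform"

definition is_seq :: "('s,'a) seq \<Rightarrow> bool" where
  "is_seq q \<longleftrightarrow> (case q of (S, \<Delta>, \<phi>) \<Rightarrow>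
      is_deflist \<Delta> \<and> (\<forall>U\<in>ddom \<Delta>. positive_in U \<phi> \<and> U \<notin> bv \<phi>))"

datatype 's rule = RAnd | ROr | RBox | RDia "'s \<Rightarrow> 's" | RSig | RUn | RThin

definition fresh :: "var \<Rightarrow> 'a deflist \<Rightarrow> 'a pform \<Rightarrow> bool" where
  "fresh U \<Delta> \<phi> \<longleftrightarrow> U \<notin> ddom \<Delta> \<and> U \<notin> allv \<phi> \<and> (\<forall>(V, \<psi>) \<in> set \<Delta>. U \<notin> allv \<psi>)"

definition is_fix :: "'a pform \<Rightarrow> bool" where
  "is_fix \<phi> \<longleftrightarrow> (\<exists>Z \<psi>. \<phi> = PNu Z \<psi> \<or> \<phi> = PMu Z \<psi>)"

fun rule_inst :: "('s,'a) lts \<Rightarrow> 's rule \<Rightarrow> ('s,'a) seq \<Rightarrow> ('s,'a) seq list \<Rightarrow> bool" where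
  "rule_inst T RAnd (S, \<Delta>, \<phi>) ps =
     (\<exists>\<phi>1 \<phi>2. \<phi> = PAnd \<phi>1 \<phi>2 \<and> ps = [(S, \<Delta>, \<phi>1), (S, \<Delta>, \<phi>2)])"
| "rule_inst T ROr (S, \<Delta>, \<phi>) ps =
     (\<exists>\<phi>1 \<phi>2 S1 S2. \<phi> = POr \<phi>1 \<phi>2 \<and> S = S1 \<union> S2 \<and> ps = [(S1, \<Delta>, \<phi>1), (S2, \<Delta>, \<phi>2)])"
| "rule_inst T RBox (S, \<Delta>, \<phi>) ps =
     (\<exists>K \<psi>. \<phi> = PBox K \<psi> \<and> ps = [({s'. \<exists>s\<in>S. kstep T s K s'}, \<Delta>, \<psi>)])"
| "rule_inst T (RDia f) (S, \<Delta>, \<phi>) ps =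
     (\<exists>K \<psi>. \<phi> = PDia K \<psi> \<and> (\<forall>s\<in>S. kstep T s K (f s)) \<and> ps = [(f ` S, \<Delta>, \<psi>)])"
| "rule_inst T RSig (S, \<Delta>, \<phi>) ps =
     (is_fix \<phi> \<and> (\<exists>U. fresh U \<Delta> \<phi> \<and> ps = [(S, \<Delta> @ [(U, \<phi>)], PVar U)]))"
| "rule_inst T RUn (S, \<Delta>, \<phi>) ps =
     (\<exists>U Z \<psi>. \<phi> = PVar U \<and> (map_of \<Delta> U = Some (PNu Z \<psi>) \<or> map_of \<Delta> U = Some (PMu Z \<psi>))
        \<and> ps = [(S, \<Delta>, psubst Z U \<psi>)])"
| "rule_inst T RThin (S, \<Delta>, \<phi>) ps =
     (\<exists>S'. S \<subseteq> S' \<and> ps = [(S', \<Delta>, \<phi>)])"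

datatype ('s,'a) tree =
    Leaf "('s,'a) seq"
  | Inner "('s,'a) seq" "'s rule" "('s,'a) tree list"

primrec label :: "('s,'a) tree \<Rightarrow> ('s,'a) seq" where
  "label (Leaf q) = q"
| "label (Inner q r ts) = q"

primrec children :: "('s,'a) tree \<Rightarrow> ('s,'a) tree list" where
  "children (Leaf q) = []"
| "children (Inner q r ts) = ts"

primrec rule_of :: "('s,'a) tree \<Rightarrow> 's rule option" where
  "rule_of (Leaf q) = None"
| "rule_of (Inner q r ts) = Some r"

primrec subt :: "('s,'a) tree \<Rightarrow> nat list \<Rightarrow> ('s,'a) tree" where
  "subt t [] = t"
| "subt t (i # p) = subt (children t ! i) p"

primrec valid :: "('s,'a) tree \<Rightarrow> nat list \<Rightarrow> bool" where
  "valid t [] = True"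
| "valid t (i # p) = (i < length (children t) \<and> valid (children t ! i) p)"

definition is_leaf :: "('s,'a) tree \<Rightarrow> nat list \<Rightarrow> bool" where
  "is_leaf t p \<longleftrightarrow> valid t p \<and> rule_of (subt t p) = None"

definition sts :: "('s,'a) tree \<Rightarrow> nat list \<Rightarrow> 's set" where
  "sts t p = fst (label (subt t p))"

definition dl :: "('s,'a) tree \<Rightarrow> nat list \<Rightarrow> 'a deflist" where
  "dl t p = fst (snd (label (subt t p)))"

definition fm :: "('s,'a) tree \<Rightarrow> nat list \<Rightarrow> 'a pform" where
  "fm t p = snd (snd (label (subt t p)))"

definition sprefix :: "nat list \<Rightarrow> nat list \<Rightarrow> bool" where
  "sprefix m n \<longleftrightarrow> (\<exists>q. q \<noteq> [] \<and> n = m @ q)"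

definition is_child :: "('s,'a) tree \<Rightarrow> nat list \<Rightarrow> nat list \<Rightarrow> bool" where
  "is_child t n' n \<longleftrightarrow> valid t n' \<and> (\<exists>i. n' = n @ [i])"

definition partial_tableau :: "('s,'a) lts \<Rightarrow> ('s,'a) tree \<Rightarrow> bool" where
  "partial_tableau T t \<longleftrightarrow>
     (\<forall>p. valid t p \<longrightarrow> is_seq (label (subt t p))
        \<and> (case subt t p of Leaf q \<Rightarrow> True
            | Inner q r ts \<Rightarrow> rule_inst T r q (map label ts)))"

definition sigma_leaf :: "('s,'a) tree \<Rightarrow> nat list \<Rightarrow> var \<Rightarrow> bool" where
  "sigma_leaf t n U \<longleftrightarrow> is_leaf t n \<and> fm t n = PVar U \<and> U \<in> ddom (dl t n)
     \<and> (\<exists>m. sprefix m n \<and> fm t m = PVar U \<and> sts t n \<subseteq> sts t m)"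

definition nu_leaf :: "('s,'a) tree \<Rightarrow> nat list \<Rightarrow> bool" where
  "nu_leaf t n \<longleftrightarrow> (\<exists>U Z \<psi>. sigma_leaf t n U \<and> map_of (dl t n) U = Some (PNu Z \<psi>))"

definition mu_leaf :: "('s,'a) tree \<Rightarrow> nat list \<Rightarrow> bool" where
  "mu_leaf t n \<longleftrightarrow> (\<exists>U Z \<psi>. sigma_leaf t n U \<and> map_of (dl t n) U = Some (PMu Z \<psi>))"

definition terminal :: "('s,'a) lts \<Rightarrow> ('s,'a) tree \<Rightarrow> nat list \<Rightarrow> bool" where
  "terminal T t n \<longleftrightarrow>
     (\<exists>Z. (fm t n = PVar Z \<or> fm t n = PNVar Z) \<and> Z \<notin> ddom (dl t n))
   \<or> (\<exists>K \<psi>. fm t n = PDia K \<psi> \<and> (\<exists>s\<in>sts t n. \<not> (\<exists>s'. kstep T s K s')))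
   \<or> (\<exists>U. sigma_leaf t n U)"

definition tableau :: "('s,'a) lts \<Rightarrow> ('s,'a) tree \<Rightarrow> bool" where
  "tableau T t \<longleftrightarrow> partial_tableau T t \<and> dl t [] = []
     \<and> (\<forall>n. is_leaf t n \<longrightarrow> terminal T t n)"

definition companion :: "('s,'a) tree \<Rightarrow> nat list \<Rightarrow> bool" where
  "companion t m \<longleftrightarrow> valid t m \<and> rule_of (subt t m) = Some RUn"

definition cl_cand :: "('s,'a) tree \<Rightarrow> nat list \<Rightarrow> nat list \<Rightarrow> bool" where
  "cl_cand t m n \<longleftrightarrow> companion t m \<and> is_leaf t n \<and> sprefix m n
     \<and> fm t n = fm t m \<and> sts t n \<subseteq> sts t m"

text \<open>The recursive definition of companion leaves, unfolded along the (bounded)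
  distance between m and n: cleaf_upto k t m n is the companion-leaf relation for
  pairs at distance at most k.\<close>
primrec cleaf_upto :: "nat \<Rightarrow> ('s,'a) tree \<Rightarrow> nat list \<Rightarrow> nat list \<Rightarrow> bool" where
  "cleaf_upto 0 t m n = False"
| "cleaf_upto (Suc k) t m n =
     (cl_cand t m n \<and> length n - length m \<le> Suc k
      \<and> \<not> (\<exists>m'. companion t m' \<and> sprefix m m' \<and> cleaf_upto k t m' n))"

definition comp_leaf :: "('s,'a) tree \<Rightarrow> nat list \<Rightarrow> nat list \<Rightarrow> bool" where
  "comp_leaf t m n \<longleftrightarrow> cleaf_upto (length n) t m n"

definition lt_step :: "('s,'a) lts \<Rightarrow> ('s,'a) tree \<Rightarrow> nat list \<Rightarrow> 's \<Rightarrow> nat list \<Rightarrow> 's \<Rightarrow> bool" where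
  "lt_step T t n' s' n s \<longleftrightarrow> is_child t n' n \<and> s' \<in> sts t n' \<and> s \<in> sts t n \<and>
     (case rule_of (subt t n) of
        Some RBox \<Rightarrow> (\<exists>K \<psi>. fm t n = PBox K \<psi> \<and> kstep T s K s')
      | Some (RDia f) \<Rightarrow> s' = f s
      | _ \<Rightarrow> s' = s)"

inductive dlt :: "('s,'a) lts \<Rightarrow> ('s,'a) tree \<Rightarrow> nat list \<Rightarrow> 's \<Rightarrow> nat list \<Rightarrow> 's \<Rightarrow> bool"
  for T t where
  dlt_refl: "valid t n \<Longrightarrow> s \<in> sts t n \<Longrightarrow> dlt T t n s n s"
| dlt_step: "dlt T t n' s' m s'' \<Longrightarrow> lt_step T t m s'' n s \<Longrightarrow> dlt T t n' s' n s"

lemma mono_tranclp_aux[mono]: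
  "(\<And>a b. x a b \<longrightarrow> y a b) \<Longrightarrow> x\<^sup>+\<^sup>+ a b \<longrightarrow> y\<^sup>+\<^sup>+ a b"
proof
  assume h: "\<And>a b. x a b \<longrightarrow> y a b" and "x\<^sup>+\<^sup>+ a b"
  from \<open>x\<^sup>+\<^sup>+ a b\<close> show "y\<^sup>+\<^sup>+ a b"
    by (induction rule: tranclp_induct) (auto intro: tranclp.intros h[rule_format])
qed

inductive cm :: "('s,'a) lts \<Rightarrow> ('s,'a) tree \<Rightarrow> nat list \<Rightarrow> 's \<Rightarrow> 's \<Rightarrow> bool"
  and cnn :: "('s,'a) lts \<Rightarrow> ('s,'a) tree \<Rightarrow> nat list \<Rightarrow> 's \<Rightarrow> nat list \<Rightarrow> 's \<Rightarrow> bool"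
  for T t where
  cm_intro: "comp_leaf t m m' \<Longrightarrow> s' \<in> sts t m' \<Longrightarrow> cnn T t m' s' m s \<Longrightarrow> cm T t m s' s"
| cnn_base: "s' \<in> sts t n' \<Longrightarrow> s \<in> sts t n \<Longrightarrow> dlt T t n' s' n s \<Longrightarrow> cnn T t n' s' n s"
| cnn_comp: "s' \<in> sts t n' \<Longrightarrow> s \<in> sts t n \<Longrightarrow> companion t m \<Longrightarrow> m \<noteq> n \<Longrightarrow> m \<noteq> n'
    \<Longrightarrow> u' \<in> sts t m \<Longrightarrow> u \<in> sts t m
    \<Longrightarrow> cnn T t n' s' m u' \<Longrightarrow> (cm T t m)\<^sup>+\<^sup>+ u' u \<Longrightarrow> dlt T t m u n s
    \<Longrightarrow> cnn T t n' s' n s"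

definition successful_leaf :: "('s,'a) lts \<Rightarrow> 's valuation \<Rightarrow> ('s,'a) tree \<Rightarrow> nat list \<Rightarrow> bool" where
  "successful_leaf T V t n \<longleftrightarrow>
     (\<exists>Z. fm t n = PVar Z \<and> Z \<notin> ddom (dl t n) \<and> sts t n \<subseteq> V Z)
   \<or> (\<exists>Z. fm t n = PNVar Z \<and> Z \<notin> ddom (dl t n) \<and> sts t n \<inter> V Z = {})
   \<or> nu_leaf t n
   \<or> (mu_leaf t n \<and> (\<exists>m. comp_leaf t m n \<and> wfP (cm T t m)))"

definition successful_tableau :: "('s,'a) lts \<Rightarrow> 's valuation \<Rightarrow> ('s,'a) tree \<Rightarrow> bool" where
  "successful_tableau T V t \<longleftrightarrow> tableau T t \<and> (\<forall>n. is_leaf t n \<longrightarrow> successful_leaf T V t n)"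

end

theory Submission
  imports Defs
begin

text \<open>The tableau unfolds every fixed point exactly once: the constant \<open>U\<close> introduced for a fixed
  point is thinned to its full extension before it is unfolded, so all later occurrences of \<open>U\<close>
  are leaves and the tree follows the syntax of the formula.  What remains is to choose the
  disjuncts and the witnesses.  Following Streett and Emerson, the signature of a state at a
  sequent is the lexicographically least list of ranks, one per definition, such that the state
  satisfies the formula once each least fixed point is replaced by its approximant of that rank.
  Choices guided by signatures never increase them, and unfolding a least fixed point strictly
  decreases its own entry.  Loops through a lower companion node do not increase that node's
  signature, whose prefix is what matters at the upper companion node; hence the companion
  order of a least fixed point embeds into the lexicographic order.\<close>

section \<open>Semantics of positive normal forms\<close>

lemma oddfree_negvar: "oddfree X p (negvar Z \<phi>) = oddfree X (if X = Z then \<not> p else p) \<phi>"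
  by (induction \<phi> arbitrary: p) auto

lemma wf_form_negvar: "wf_form (negvar Z \<phi>) = wf_form \<phi>"
  by (induction \<phi>) (auto simp: oddfree_negvar)

lemma sem_negvar: "sem T V (negvar Z \<phi>) = sem T (V(Z := - V Z)) \<phi>"
proof (induction \<phi> arbitrary: V)
  case (Nu Y \<phi>)
  show ?case
  proof (cases "Y = Z")
    case False
    then have "(V(Y := X))(Z := - (V(Y := X)) Z) = (V(Z := - V Z))(Y := X)" for X
      by (auto simp: fun_eq_iff)
    then have "sem T (V(Y := X)) (negvar Z \<phi>) = sem T ((V(Z := - V Z))(Y := X)) \<phi>" for X
      by (simp only: Nu)
    then show ?thesis using False by (simp only: negvar.simps sem.simps if_False)
  qed (simp only: negvar.simps sem.simps if_True fun_upd_upd simp_thms)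
qed auto

text \<open>Negation exchanges the two polarities, so the induction carries both at once.\<close>

lemma sem_oddfree_mono:
  assumes "A \<subseteq> B"
  shows "(\<not> oddfree Z False \<phi> \<longrightarrow> sem T (V(Z := A)) \<phi> \<subseteq> sem T (V(Z := B)) \<phi>) \<and>
         (\<not> oddfree Z True \<phi> \<longrightarrow> sem T (V(Z := B)) \<phi> \<subseteq> sem T (V(Z := A)) \<phi>)"
proof (induction \<phi> arbitrary: V)
  case (Var Y)
  then show ?case using assms by auto
next
  case (Neg \<phi>)
  from Neg[of V] show ?case by auto
next
  case (And \<phi>1 \<phi>2)
  from And.IH(1)[of V] And.IH(2)[of V] show ?case by auto
next
  case (Box K \<phi>)
  from Box[of V] show ?case by auto
next
  case (Nu Y \<phi>)
  show ?case
  proof (cases "Y = Z")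
    case False
    then have "V(Z := X, Y := S) = V(Y := S, Z := X)" for X S
      by (rule fun_upd_twist[symmetric])
    then have IH:
      "\<not> oddfree Z False \<phi> \<Longrightarrow> sem T (V(Z := A, Y := S)) \<phi> \<subseteq> sem T (V(Z := B, Y := S)) \<phi>"
      "\<not> oddfree Z True \<phi> \<Longrightarrow> sem T (V(Z := B, Y := S)) \<phi> \<subseteq> sem T (V(Z := A, Y := S)) \<phi>" for S
      using Nu[of "V(Y := S)"] by (simp_all only: simp_thms)
    show ?thesis
    proof (intro conjI impI)
      assume "\<not> oddfree Z False (Nu Y \<phi>)"
      then show "sem T (V(Z := A)) (Nu Y \<phi>) \<subseteq> sem T (V(Z := B)) (Nu Y \<phi>)"
        unfolding sem.simps using False IH(1) by (intro Union_mono) auto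
    next
      assume "\<not> oddfree Z True (Nu Y \<phi>)"
      then show "sem T (V(Z := B)) (Nu Y \<phi>) \<subseteq> sem T (V(Z := A)) (Nu Y \<phi>)"
        unfolding sem.simps using False IH(2) by (intro Union_mono) auto
    qed
  qed (simp only: sem.simps fun_upd_upd order_refl simp_thms)
qed

lemma psem_simps:
  "psem T V (PVar Z) = V Z"
  "psem T V (PNVar Z) = - V Z"
  "psem T V (PAnd \<phi> \<psi>) = psem T V \<phi> \<inter> psem T V \<psi>"
  "psem T V (POr \<phi> \<psi>) = psem T V \<phi> \<union> psem T V \<psi>"
  "psem T V (PBox K \<phi>) = {s. \<forall>s'. kstep T s K s' \<longrightarrow> s' \<in> psem T V \<phi>}"
  "psem T V (PDia K \<phi>) = {s. \<exists>s'. kstep T s K s' \<and> s' \<in> psem T V \<phi>}"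
  "psem T V (PNu Z \<phi>) = \<Union>{X. X \<subseteq> psem T (V(Z := X)) \<phi>}"
  "psem T V (PMu Z \<phi>) = \<Inter>{X. psem T (V(Z := X)) \<phi> \<subseteq> X}"
proof -
  define F where "F X = sem T (V(Z := X)) (to_core \<phi>)" for X
  \<comment> \<open>The De Morgan dual of the union: complementing \<open>X\<close> matches the sets
    \<open>X \<subseteq> - F (- X)\<close> with the sets closed under \<open>F\<close>.\<close>
  have "- \<Union>{X. X \<subseteq> - F (- X)} = \<Inter>{X. F X \<subseteq> X}"
  proof (intro equalityI subsetI InterI)
    fix s X assume s: "s \<in> - \<Union>{X. X \<subseteq> - F (- X)}" and "X \<in> {X. F X \<subseteq> X}"
    then have "- X \<subseteq> - F (- (- X))" by simp
    then have "- X \<in> {X. X \<subseteq> - F (- X)}" by (rule CollectI)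
    then show "s \<in> X" using s by blast
  next
    fix s assume s: "s \<in> \<Inter>{X. F X \<subseteq> X}"
    have "s \<notin> X" if "X \<subseteq> - F (- X)" for X
    proof -
      have "F (- X) \<subseteq> - X" using that by blast
      then show ?thesis using s by blast
    qed
    then show "s \<in> - \<Union>{X. X \<subseteq> - F (- X)}" by blast
  qed
  then show "psem T V (PMu Z \<phi>) = \<Inter>{X. psem T (V(Z := X)) \<phi> \<subseteq> X}"
    by (simp add: psem_def sem_negvar F_def)
qed (auto simp: psem_def)

text \<open>One half of Knaster-Tarski: a post-fixed set lies inside the union, and the parity
  condition makes the body monotone in \<open>Z\<close>.\<close>

lemma psem_unfold_Nu:
  assumes "wf_form (to_core (PNu Z \<phi>))"
  shows "psem T V (PNu Z \<phi>) \<subseteq> psem T (V(Z := psem T V (PNu Z \<phi>))) \<phi>"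
proof
  fix s assume "s \<in> psem T V (PNu Z \<phi>)"
  then obtain X where X: "X \<subseteq> psem T (V(Z := X)) \<phi>" "s \<in> X"
    by (auto simp: psem_simps)
  have "X \<subseteq> psem T V (PNu Z \<phi>)"
    using X by (auto simp: psem_simps)
  then have "psem T (V(Z := X)) \<phi> \<subseteq> psem T (V(Z := psem T V (PNu Z \<phi>))) \<phi>"
    using sem_oddfree_mono[of X _ Z "to_core \<phi>" T V] assms by (simp add: psem_def)
  then show "s \<in> psem T (V(Z := psem T V (PNu Z \<phi>))) \<phi>"
    using X by blast
qed

text \<open>As \<open>allv\<close> also contains the binders, the update at \<open>U\<close>
  commutes with the one made by each binder.\<close>

lemma psem_update_fresh: "U \<notin> allv \<phi> \<Longrightarrow> psem T (V(U := X)) \<phi> = psem T V \<phi>"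
proof (induction \<phi> arbitrary: V)
  case (PNu Z \<phi>)
  then have "(V(U := X))(Z := Y) = (V(Z := Y))(U := X)" for Y
    by (intro fun_upd_twist) auto
  moreover have "psem T ((V(Z := Y))(U := X)) \<phi> = psem T (V(Z := Y)) \<phi>" for Y
    using PNu.prems by (intro PNu.IH) simp
  ultimately show ?case by (simp only: psem_simps)
next
  case (PMu Z \<phi>)
  then have "(V(U := X))(Z := Y) = (V(Z := Y))(U := X)" for Y
    by (intro fun_upd_twist) auto
  moreover have "psem T ((V(Z := Y))(U := X)) \<phi> = psem T (V(Z := Y)) \<phi>" for Y
    using PMu.prems by (intro PMu.IH) simp
  ultimately show ?case by (simp only: psem_simps)
qed (auto simp: psem_simps)

text \<open>Freshness excludes capture: no binder on the way changes the value of
  \<open>U\<close>.\<close>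

lemma psem_psubst: "U \<notin> allv \<phi> \<Longrightarrow> psem T V (psubst Z U \<phi>) = psem T (V(Z := V U)) \<phi>"
proof (induction \<phi> arbitrary: V)
  case (PNu Y \<phi>)
  show ?case
  proof (cases "Y = Z")
    case False
    moreover have "U \<noteq> Y" "U \<notin> allv \<phi>" using PNu.prems by auto
    ultimately have "(V(Y := X))(Z := (V(Y := X)) U) = (V(Z := V U))(Y := X)" for X
      by (auto simp: fun_eq_iff)
    then have "psem T (V(Y := X)) (psubst Z U \<phi>) = psem T ((V(Z := V U))(Y := X)) \<phi>" for X
      by (simp only: PNu.IH[OF \<open>U \<notin> allv \<phi>\<close>])
    then show ?thesis using False by (simp only: psubst.simps psem_simps if_False)
  qed (simp only: psubst.simps psem_simps if_True fun_upd_upd simp_thms)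
next
  case (PMu Y \<phi>)
  show ?case
  proof (cases "Y = Z")
    case False
    moreover have "U \<noteq> Y" "U \<notin> allv \<phi>" using PMu.prems by auto
    ultimately have "(V(Y := X))(Z := (V(Y := X)) U) = (V(Z := V U))(Y := X)" for X
      by (auto simp: fun_eq_iff)
    then have "psem T (V(Y := X)) (psubst Z U \<phi>) = psem T ((V(Z := V U))(Y := X)) \<phi>" for X
      by (simp only: PMu.IH[OF \<open>U \<notin> allv \<phi>\<close>])
    then show ?thesis using False by (simp only: psubst.simps psem_simps if_False)
  qed (simp only: psubst.simps psem_simps if_True fun_upd_upd simp_thms)
qed (auto simp: psem_simps)

section \<open>Parity of occurrences and well-formedness under substitution\<close>

lemma oddfree_PMu: "oddfree X p (to_core (PMu Z \<phi>)) = (Z \<noteq> X \<and> oddfree X p (to_core \<phi>))"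
  by (auto simp: oddfree_negvar)

text \<open>The negations in the encoding of a least fixed point cancel, so \<open>Z\<close> obeys
  the same parity condition as under \<open>PNu\<close>. This lemma and \<open>oddfree_PMu\<close>
  serve later in place of unfolding the encoding.\<close>

lemma wf_form_PMu:
  "wf_form (to_core (PMu Z \<phi>)) = (\<not> oddfree Z False (to_core \<phi>) \<and> wf_form (to_core \<phi>))"
  by (auto simp: oddfree_negvar wf_form_negvar)

lemma oddfree_in_allv: "oddfree X p (to_core \<phi>) \<Longrightarrow> X \<in> allv \<phi>"
proof (induction \<phi> arbitrary: p)
  case (PMu Z \<phi>)
  then show ?case by (auto simp: oddfree_PMu simp del: to_core.simps(8))
qed auto

lemma oddfree_psubst:
  "U \<notin> allv \<phi> \<Longrightarrow> X \<noteq> U \<Longrightarrow>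
   oddfree X p (to_core (psubst Z U \<phi>)) = (X \<noteq> Z \<and> oddfree X p (to_core \<phi>))"
proof (induction \<phi> arbitrary: p)
  case (PMu Y \<phi>)
  then show ?case by (auto simp: oddfree_PMu simp del: to_core.simps(8))
qed auto

lemma oddfree_psubst_new:
  "U \<notin> allv \<phi> \<Longrightarrow> oddfree U p (to_core (psubst Z U \<phi>)) = oddfree Z p (to_core \<phi>)"
proof (induction \<phi> arbitrary: p)
  case (PNu Y \<phi>)
  \<comment> \<open>If the binder is \<open>Z\<close>, nothing is replaced below it, and
    \<open>U\<close> does not occur there.\<close>
  then show ?case using oddfree_in_allv[of U p \<phi>] by auto
next
  case (PMu Y \<phi>)
  then show ?case using oddfree_in_allv[of U p \<phi>]
    by (auto simp: oddfree_PMu simp del: to_core.simps(8))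
qed auto

lemma wf_form_psubst:
  "U \<notin> allv \<phi> \<Longrightarrow> wf_form (to_core \<phi>) \<Longrightarrow> wf_form (to_core (psubst Z U \<phi>))"
proof (induction \<phi>)
  case (PMu Y \<phi>)
  then show ?case by (auto simp: wf_form_PMu oddfree_psubst simp del: to_core.simps(8))
qed (auto simp: oddfree_psubst)

lemma bv_psubst [simp]: "bv (psubst Z U \<phi>) = bv \<phi>"
  by (induction \<phi>) auto

lemma size_psubst [simp]: "size (psubst Z U \<phi>) = size \<phi>"
  by (induction \<phi>) auto

lemma bv_subset_allv: "bv \<phi> \<subseteq> allv \<phi>"
  by (induction \<phi>) auto

lemma fv_subset_allv: "fv \<phi> \<subseteq> allv \<phi>"
  by (induction \<phi>) auto

lemma finite_allv: "finite (allv \<phi>)"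
  by (induction \<phi>) auto

lemma ex_fresh: "\<exists>U. fresh U \<Delta> \<phi>"
proof -
  have fin: "finite (ddom \<Delta> \<union> allv \<phi> \<union> (\<Union>(Y, \<psi>) \<in> set \<Delta>. allv \<psi>))"
    by (auto simp: ddom_def finite_allv)
  obtain U where "U \<notin> ddom \<Delta> \<union> allv \<phi> \<union> (\<Union>(Y, \<psi>) \<in> set \<Delta>. allv \<psi>)"
    using ex_new_if_finite[OF infinite_UNIV_nat fin] by (rule exE)
  then show ?thesis by (auto simp: fresh_def)
qed

section \<open>Ranks and approximants\<close>

text \<open>A well-order on \<^typ>\<open>'s set\<close> is long enough to index the approximants of every
  least fixed point over \<^typ>\<open>'s\<close>, by Cantor's theorem.\<close>

definition rank_ord :: "'s set rel" where
  "rank_ord = (SOME r. wf r \<and> total r \<and> trans r)"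

lemma rank_ord: "wf (rank_ord :: 's set rel)" "total (rank_ord :: 's set rel)"
  "trans (rank_ord :: 's set rel)"
proof -
  obtain r :: "'s set rel" where r: "well_order_on UNIV r"
    using well_order_on by blast
  then have "linear_order r" "wf (r - Id)"
    unfolding well_order_on_def by blast+
  then have "wf (r - Id) \<and> total (r - Id) \<and> trans (r - Id)"
    unfolding linear_order_on_def partial_order_on_def preorder_on_def
    by (simp add: trans_diff_Id)
  then have "wf (rank_ord :: 's set rel) \<and> total (rank_ord :: 's set rel)
      \<and> trans (rank_ord :: 's set rel)"
    unfolding rank_ord_def by (rule someI)
  then show "wf (rank_ord :: 's set rel)" "total (rank_ord :: 's set rel)"
    "trans (rank_ord :: 's set rel)" by blast+
qed

text \<open>The transfinite iteration of \<open>F\<close> from the empty set; one union covers the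
  zero, successor and limit cases.\<close>

definition stage :: "('s set \<Rightarrow> 's set) \<Rightarrow> 's set \<Rightarrow> 's set" where
  "stage F = wfrec rank_ord (\<lambda>f a. \<Union>b \<in> {b. (b, a) \<in> rank_ord}. F (f b))"

lemma stage_unfold: "stage F a = (\<Union>b \<in> {b. (b, a) \<in> rank_ord}. F (stage F b))"
  unfolding stage_def by (subst wfrec[OF rank_ord(1)]) (auto simp: cut_apply)

text \<open>Otherwise every stage would gain a new element, giving an injection from sets of states
  to states.\<close>

lemma stage_closed: "\<exists>a. F (stage F a) \<subseteq> stage F a"
proof (rule ccontr)
  assume "\<not> ?thesis"
  then have "\<forall>a. \<exists>x. x \<in> F (stage F a) \<and> x \<notin> stage F a"
    by blast
  then obtain g where g: "\<And>a. g a \<in> F (stage F a)" "\<And>a. g a \<notin> stage F a"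
    by metis
  \<comment> \<open>For \<open>a\<close> below \<open>b\<close>, \<open>stage F b\<close> includes
    \<open>F (stage F a)\<close>; hence it contains \<open>g a\<close> but not
    \<open>g b\<close>.\<close>
  have "g a \<noteq> g b" if "(a, b) \<in> rank_ord" for a b
    using that g(1)[of a] g(2)[of b] unfolding stage_unfold[of F b] by auto
  then have "inj g"
    using rank_ord(2) by (metis UNIV_I injI total_on_def)
  then have "surj (inv g)"
    by (rule inj_imp_surj_inv)
  then show False
    using Cantors_theorem[of UNIV] by auto
qed

text \<open>Greatest fixed points also take a rank argument, so that positions in a rank list match
  positions in the definition list.\<close>

fun approx :: "('s,'a) lts \<Rightarrow> 'a pform \<Rightarrow> 's valuation \<Rightarrow> 's set \<Rightarrow> 's set" where
  "approx T (PMu Z \<phi>) V a = stage (\<lambda>X. psem T (V(Z := X)) \<phi>) a"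
| "approx T \<phi> V a = psem T V \<phi>"

text \<open>A closed stage is a pre-fixed point and so contains the least fixed point.\<close>

lemma psem_subset_approx: "\<exists>a. psem T V \<phi> \<subseteq> approx T \<phi> V a"
proof (cases \<phi>)
  case (PMu Z \<psi>)
  then show ?thesis
    using stage_closed[of "\<lambda>X. psem T (V(Z := X)) \<psi>"] by (auto simp: psem_simps)
qed auto

section \<open>Signatures\<close>

text \<open>Comparing lengths first gives a well-founded total order on all lists; on lists of equal
  length it is lexicographic.\<close>

abbreviation sig_less :: "'s set list rel" where
  "sig_less \<equiv> lenlex rank_ord"

lemma wf_sig_less: "wf sig_less"
  using rank_ord(1) by (rule wf_lenlex)

lemma sig_less_append:
  "(x, y) \<in> rank_ord \<Longrightarrow> length xs = length ys \<Longrightarrow> (zs @ x # xs, zs @ y # ys) \<in> sig_less"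
  unfolding lenlex_conv lex_conv by force

text \<open>Truncation either keeps the first difference or cuts it off and leaves equal lists;
  strictness may be lost.\<close>

lemma sig_less_take:
  assumes "(xs, ys) \<in> sig_less\<^sup>=" "length xs = length ys"
  shows "(take k xs, take k ys) \<in> sig_less\<^sup>="
proof (cases "xs = ys")
  case False
  then have "(xs, ys) \<in> lex rank_ord"
    using assms by (auto simp: lenlex_conv)
  then obtain zs x y xs' ys' where
    *: "xs = zs @ x # xs'" "ys = zs @ y # ys'" "(x, y) \<in> rank_ord"
    unfolding lex_conv by blast
  show ?thesis
  proof (cases "k \<le> length zs")
    case False
    then obtain j where "k = length zs + Suc j"
      by (metis add_Suc_right less_imp_Suc_add not_le)
    then have "take k xs = zs @ x # take j xs'" "take k ys = zs @ y # take j ys'"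
      "length (take j xs') = length (take j ys')"
      using * assms(2) by auto
    then show ?thesis using sig_less_append[OF *(3)] by simp
  qed (use * in simp)
qed simp

lemma sig_less_trans: "trans sig_less"
  using rank_ord(3) by (rule lenlex_transI)

lemma sig_le_trans:
  "(xs, ys) \<in> sig_less\<^sup>= \<Longrightarrow> (ys, zs) \<in> sig_less\<^sup>= \<Longrightarrow> (xs, zs) \<in> sig_less\<^sup>="
  "(xs, ys) \<in> sig_less\<^sup>= \<Longrightarrow> (ys, zs) \<in> sig_less \<Longrightarrow> (xs, zs) \<in> sig_less"
  using sig_less_trans by (auto dest: transD)

text \<open>The update of \<open>V\<close> by the definition list, with approximants for least fixed
  points. Each is computed under the approximants of the earlier definitions.\<close>

primrec dval :: "('s,'a) lts \<Rightarrow> 'a deflist \<Rightarrow> 's valuation \<Rightarrow> 's set list \<Rightarrow> 's valuation" where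
  "dval T [] V xs = V"
| "dval T (d # \<Delta>) V xs = dval T \<Delta> (V(fst d := approx T (snd d) V (hd xs))) (tl xs)"

lemma dval_append:
  "length xs = length \<Delta> \<Longrightarrow> dval T (\<Delta> @ \<Delta>') V (xs @ ys) = dval T \<Delta>' (dval T \<Delta> V xs) ys"
  by (induction xs \<Delta> arbitrary: V rule: list_induct2) auto

lemma dval_other: "Z \<notin> ddom \<Delta> \<Longrightarrow> dval T \<Delta> V xs Z = V Z"
  by (induction \<Delta> arbitrary: V xs) (auto simp: ddom_def)

context
  fixes T :: "('s,'a) lts" and V :: "'s valuation"
begin

text \<open>A list \<open>xs\<close> assigns a rank to each definition; the ranks of greatest fixed points are
  irrelevant.\<close>

definition holds :: "'a deflist \<Rightarrow> 'a pform \<Rightarrow> 's \<Rightarrow> 's set list \<Rightarrow> bool" where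
  "holds \<Delta> \<phi> s xs \<longleftrightarrow> length xs = length \<Delta> \<and> s \<in> psem T (dval T \<Delta> V xs) \<phi>"

definition ext :: "'a deflist \<Rightarrow> 'a pform \<Rightarrow> 's set" where
  "ext \<Delta> \<phi> = {s. \<exists>xs. holds \<Delta> \<phi> s xs}"

definition sig :: "'a deflist \<Rightarrow> 'a pform \<Rightarrow> 's \<Rightarrow> 's set list" where
  "sig \<Delta> \<phi> s = (SOME xs. holds \<Delta> \<phi> s xs \<and> (\<forall>ys. holds \<Delta> \<phi> s ys \<longrightarrow> (xs, ys) \<in> sig_less\<^sup>=))"

text \<open>Well-foundedness gives a minimal list, and totality makes it least.\<close>

lemma ex_sig:
  assumes "holds \<Delta> \<phi> s zs"
  shows "\<exists>xs. holds \<Delta> \<phi> s xs \<and> (\<forall>ys. holds \<Delta> \<phi> s ys \<longrightarrow> (xs, ys) \<in> sig_less\<^sup>=)"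
proof -
  obtain xs where "holds \<Delta> \<phi> s xs" "\<And>ys. (ys, xs) \<in> sig_less \<Longrightarrow> \<not> holds \<Delta> \<phi> s ys"
    using wfE_min[OF wf_sig_less, of zs "{xs. holds \<Delta> \<phi> s xs}"] assms by auto
  moreover have "total (sig_less :: 's set list rel)"
    using rank_ord(2) by (rule total_lenlex)
  ultimately show ?thesis
    by (metis UNIV_I UnCI pair_in_Id_conv total_on_def)
qed

lemma sig_least: "holds \<Delta> \<phi> s xs \<Longrightarrow> (sig \<Delta> \<phi> s, xs) \<in> sig_less\<^sup>="
  using someI_ex[OF ex_sig] unfolding sig_def by blast

lemma holds_sig: "s \<in> ext \<Delta> \<phi> \<Longrightarrow> holds \<Delta> \<phi> s (sig \<Delta> \<phi> s)"
  using someI_ex[OF ex_sig] unfolding sig_def ext_def by blast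

lemma length_sig: "s \<in> ext \<Delta> \<phi> \<Longrightarrow> length (sig \<Delta> \<phi> s) = length \<Delta>"
  using holds_sig by (auto simp: holds_def)

lemma holds_snoc:
  "holds (\<Delta> @ [(U, \<theta>)]) \<phi> s ys \<longleftrightarrow>
   (\<exists>xs a. ys = xs @ [a] \<and> length xs = length \<Delta> \<and>
      s \<in> psem T ((dval T \<Delta> V xs)(U := approx T \<theta> (dval T \<Delta> V xs) a)) \<phi>)"
  by (cases ys rule: rev_cases) (auto simp: holds_def dval_append)

lemma holds_PVar_append:
  assumes "holds (\<Delta> @ \<Delta>') (PVar U) s xs" "U \<notin> ddom \<Delta>'"
  shows "holds \<Delta> (PVar U) s (take (length \<Delta>) xs)"
proof -
  have "dval T (\<Delta> @ \<Delta>') V (take (length \<Delta>) xs @ drop (length \<Delta>) xs) U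
      = dval T \<Delta> V (take (length \<Delta>) xs) U"
    using assms by (subst dval_append) (auto simp: holds_def dval_other)
  then show ?thesis using assms by (auto simp: holds_def psem_simps)
qed

text \<open>A closed stage supplies the new rank, while all earlier ranks are kept.\<close>

lemma holds_fix:
  assumes "holds \<Delta> \<phi> s xs"
  shows "\<exists>a. holds (\<Delta> @ [(U, \<phi>)]) (PVar U) s (xs @ [a])"
proof -
  obtain a where "psem T (dval T \<Delta> V xs) \<phi> \<subseteq> approx T \<phi> (dval T \<Delta> V xs) a"
    using psem_subset_approx by (rule exE)
  then show ?thesis
    using assms by (auto simp: holds_def dval_append psem_simps)
qed

text \<open>\<open>U\<close> denotes the full greatest fixed point whatever its rank, so unfolding
  can keep the ranks.\<close>

lemma holds_unfold_Nu:
  assumes "wf_form (to_core (PNu Z \<psi>))" "U \<notin> allv (PNu Z \<psi>)"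
    and "holds (\<Delta> @ [(U, PNu Z \<psi>)]) (PVar U) s xs"
  shows "holds (\<Delta> @ [(U, PNu Z \<psi>)]) (psubst Z U \<psi>) s xs"
proof -
  have sub: "psem T W (PNu Z \<psi>) \<subseteq> psem T (W(U := psem T W (PNu Z \<psi>))) (psubst Z U \<psi>)" for W
  proof -
    have "(W(U := X))(Z := X) = (W(Z := X))(U := X)" for X
      by (simp add: fun_eq_iff)
    then show ?thesis
      using assms(2) psem_unfold_Nu[OF assms(1), of T W]
      by (simp add: psem_psubst psem_update_fresh)
  qed
  obtain ys a where ys: "xs = ys @ [a]" "length ys = length \<Delta>"
    "s \<in> psem T (dval T \<Delta> V ys) (PNu Z \<psi>)"
    using assms(3) by (auto simp: holds_snoc psem_simps(1))
  show ?thesis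
    unfolding holds_snoc approx.simps using ys(1,2) subsetD[OF sub ys(3)] by blast
qed

text \<open>A state enters stage \<open>a\<close> through \<open>F\<close> applied to some stage
  \<open>b\<close> below \<open>a\<close>; the last rank drops from \<open>a\<close> to
  \<open>b\<close>.\<close>

lemma holds_unfold_Mu:
  assumes "U \<notin> allv (PMu Z \<psi>)"
    and "holds (\<Delta> @ [(U, PMu Z \<psi>)]) (PVar U) s xs"
  shows "\<exists>ys. holds (\<Delta> @ [(U, PMu Z \<psi>)]) (psubst Z U \<psi>) s ys \<and> (ys, xs) \<in> sig_less"
proof -
  obtain zs a where xs: "xs = zs @ [a]" "length zs = length \<Delta>"
    and s: "s \<in> stage (\<lambda>X. psem T ((dval T \<Delta> V zs)(Z := X)) \<psi>) a"
    using assms(2) by (auto simp: holds_snoc psem_simps)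
  then obtain b where b: "(b, a) \<in> rank_ord"
    "s \<in> psem T ((dval T \<Delta> V zs)(Z := stage (\<lambda>X. psem T ((dval T \<Delta> V zs)(Z := X)) \<psi>) b)) \<psi>"
    by (subst (asm) stage_unfold) auto
  have "holds (\<Delta> @ [(U, PMu Z \<psi>)]) (psubst Z U \<psi>) s (zs @ [b])"
    using b(2) xs(2) assms(1)
    by (auto simp: holds_snoc psem_psubst psem_update_fresh fun_upd_twist[of U Z])
  then show ?thesis using sig_less_append[OF b(1)] xs by blast
qed

section \<open>Construction of the tree\<close>

definition is_mu :: "'a pform \<Rightarrow> bool" where
  "is_mu \<phi> \<longleftrightarrow> (\<exists>Z \<psi>. \<phi> = PMu Z \<psi>)"

text \<open>The counterpart of \<open>lt_step\<close> on labels alone, usable before the nodes of a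
  whole tree are addressed by paths.\<close>

definition local_step :: "('s,'a) seq \<Rightarrow> 's rule \<Rightarrow> ('s,'a) seq \<Rightarrow> 's \<Rightarrow> 's \<Rightarrow> bool" where
  "local_step q r q' s' s \<longleftrightarrow> s' \<in> fst q' \<and> s \<in> fst q \<and>
     (case r of
        RBox \<Rightarrow> (\<exists>K \<psi>. snd (snd q) = PBox K \<psi> \<and> kstep T s K s')
      | RDia f \<Rightarrow> s' = f s
      | _ \<Rightarrow> s' = s)"

text \<open>Truncation ignores the rank of a constant that the rule has just introduced. In a
  \<open>good\<close> tree, \<open>RUn\<close> unfolds the last definition, whose kind therefore
  decides on strictness.\<close>

fun descends :: "('s,'a) seq \<Rightarrow> 's rule \<Rightarrow> ('s,'a) seq \<Rightarrow> bool" where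
  "descends (S, \<Delta>, \<phi>) r (S', \<Delta>', \<phi>') \<longleftrightarrow> (\<exists>\<Delta>1. \<Delta>' = \<Delta> @ \<Delta>1) \<and>
     (\<forall>s' s. local_step (S, \<Delta>, \<phi>) r (S', \<Delta>', \<phi>') s' s \<longrightarrow>
        (take (length \<Delta>) (sig \<Delta>' \<phi>' s'), sig \<Delta> \<phi> s)
          \<in> (if r = RUn \<and> is_mu (snd (last \<Delta>)) then sig_less else sig_less\<^sup>=))"

abbreviation newest :: "'a deflist \<Rightarrow> var" where
  "newest \<Delta> \<equiv> fst (last \<Delta>)"

text \<open>The set \<open>C\<close> records the definition lists of the companion nodes passed on the way from
  the root.  A companion node carries the full extension of its constant, so that every later
  occurrence of the constant is a leaf.\<close>

inductive good :: "'a deflist set \<Rightarrow> ('s,'a) tree \<Rightarrow> bool" where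
  good_Leaf: "is_seq (S, \<Delta>, \<phi>) \<Longrightarrow> S \<subseteq> ext \<Delta> \<phi> \<Longrightarrow> \<phi> = PVar Z \<or> \<phi> = PNVar Z \<Longrightarrow>
     (Z \<in> ddom \<Delta> \<Longrightarrow> \<exists>\<Delta>1 \<in> C. \<Delta>1 \<noteq> [] \<and> newest \<Delta>1 = Z \<and> (\<exists>\<Delta>2. \<Delta> = \<Delta>1 @ \<Delta>2)) \<Longrightarrow>
     good C (Leaf (S, \<Delta>, \<phi>))"
| good_Inner: "is_seq (S, \<Delta>, \<phi>) \<Longrightarrow> S \<subseteq> ext \<Delta> \<phi> \<Longrightarrow>
     rule_inst T r (S, \<Delta>, \<phi>) (map label ts) \<Longrightarrow>
     (\<And>t. t \<in> set ts \<Longrightarrow> descends (S, \<Delta>, \<phi>) r (label t)) \<Longrightarrow>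
     (r = RUn \<Longrightarrow> \<Delta> \<noteq> [] \<and> \<phi> = PVar (newest \<Delta>) \<and> S = ext \<Delta> \<phi> \<and> newest \<Delta> \<notin> newest ` C) \<Longrightarrow>
     (\<And>t. t \<in> set ts \<Longrightarrow> good (if r = RUn then insert \<Delta> C else C) t) \<Longrightarrow>
     good C (Inner (S, \<Delta>, \<phi>) r ts)"

text \<open>If the parent's signature is still admissible at the child, the child's least one cannot
  exceed it. Disjuncts and witnesses are chosen to meet this condition.\<close>

lemma descends_same_deflist:
  assumes "S \<subseteq> ext \<Delta> \<phi>" "r \<noteq> RUn"
    and "\<And>s' s. local_step (S, \<Delta>, \<phi>) r (S', \<Delta>, \<phi>') s' s \<Longrightarrow> s \<in> ext \<Delta> \<phi> \<Longrightarrow>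
           holds \<Delta> \<phi>' s' (sig \<Delta> \<phi> s)"
  shows "descends (S, \<Delta>, \<phi>) r (S', \<Delta>, \<phi>')"
proof -
  have "(take (length \<Delta>) (sig \<Delta> \<phi>' s'), sig \<Delta> \<phi> s) \<in> sig_less\<^sup>="
    if l: "local_step (S, \<Delta>, \<phi>) r (S', \<Delta>, \<phi>') s' s" for s' s
  proof -
    have h: "holds \<Delta> \<phi>' s' (sig \<Delta> \<phi> s)"
      using assms l by (auto simp: local_step_def)
    then have "s' \<in> ext \<Delta> \<phi>'" by (auto simp: ext_def)
    then show ?thesis using sig_least[OF h] by (simp add: length_sig)
  qed
  then show ?thesis using assms(2) by auto
qed

lemma holds_connectives:
  "holds \<Delta> (PAnd \<phi> \<psi>) s xs \<longleftrightarrow> holds \<Delta> \<phi> s xs \<and> holds \<Delta> \<psi> s xs"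
  "holds \<Delta> (POr \<phi> \<psi>) s xs \<longleftrightarrow> holds \<Delta> \<phi> s xs \<or> holds \<Delta> \<psi> s xs"
  "holds \<Delta> (PBox K \<phi>) s xs \<longleftrightarrow> length xs = length \<Delta> \<and> (\<forall>s'. kstep T s K s' \<longrightarrow> holds \<Delta> \<phi> s' xs)"
  "holds \<Delta> (PDia K \<phi>) s xs \<longleftrightarrow> (\<exists>s'. kstep T s K s' \<and> holds \<Delta> \<phi> s' xs)"
  by (auto simp: holds_def psem_simps)

lemma is_seq_subformulas:
  "is_seq (S, \<Delta>, PAnd \<phi> \<psi>) \<Longrightarrow> is_seq (S', \<Delta>, \<phi>) \<and> is_seq (S', \<Delta>, \<psi>)"
  "is_seq (S, \<Delta>, POr \<phi> \<psi>) \<Longrightarrow> is_seq (S', \<Delta>, \<phi>) \<and> is_seq (S', \<Delta>, \<psi>)"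
  "is_seq (S, \<Delta>, PBox K \<phi>) \<Longrightarrow> is_seq (S', \<Delta>, \<phi>)"
  "is_seq (S, \<Delta>, PDia K \<phi>) \<Longrightarrow> is_seq (S', \<Delta>, \<phi>)"
  by (auto simp: is_seq_def positive_in_def)

lemma is_deflist_snoc:
  assumes "is_seq (S, \<Delta>, \<phi>)" "fresh U \<Delta> \<phi>"
  shows "is_deflist (\<Delta> @ [(U, \<phi>)])"
proof -
  have d: "is_deflist \<Delta>" and b: "\<And>X. X \<in> ddom \<Delta> \<Longrightarrow> X \<notin> bv \<phi>"
    using assms(1) by (auto simp: is_seq_def)
  have U: "U \<notin> ddom \<Delta>" "U \<notin> allv \<phi>" "\<And>d. d \<in> set \<Delta> \<Longrightarrow> U \<notin> allv (snd d)"
    using assms(2) by (auto simp: fresh_def)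
  then have "\<And>d. d \<in> set \<Delta> \<Longrightarrow> U \<notin> bv (snd d) \<and> U \<notin> fv (snd d)" "U \<notin> bv \<phi>" "U \<notin> fv \<phi>"
    using bv_subset_allv fv_subset_allv by blast+
  then show ?thesis
    using d b U(1) unfolding is_deflist_def ddom_def
    by (auto simp: nth_append less_Suc_eq)
qed

lemma ddom_snoc: "ddom (\<Delta> @ [(U, \<phi>)]) = insert U (ddom \<Delta>)"
  by (auto simp: ddom_def)

text \<open>Positivity of \<open>U\<close> in the unfolding is the parity condition on
  \<open>Z\<close> in a well-formed fixed point.\<close>

lemma is_seq_unfold:
  assumes "is_seq (S, \<Delta>, \<phi>)" "fresh U \<Delta> \<phi>" "wf_form (to_core \<phi>)"
    and "\<phi> = PNu Z \<psi> \<or> \<phi> = PMu Z \<psi>"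
  shows "is_seq (S', \<Delta> @ [(U, \<phi>)], psubst Z U \<psi>)"
proof -
  have U: "U \<notin> allv \<psi>" "U \<notin> bv \<psi>" "U \<notin> ddom \<Delta>"
    using assms(2,4) bv_subset_allv[of \<psi>] by (auto simp: fresh_def)
  have "\<not> oddfree Z False (to_core \<psi>)"
    using assms(3,4) wf_form_PMu[of Z \<psi>] by auto
  then have "positive_in U (psubst Z U \<psi>)"
    by (simp add: positive_in_def oddfree_psubst_new U)
  moreover have "positive_in X (psubst Z U \<psi>) \<and> X \<notin> bv \<psi>" if "X \<in> ddom \<Delta>" for X
  proof -
    have X: "X \<noteq> U" "X \<noteq> Z" "X \<notin> bv \<psi>" "positive_in X \<phi>"
      using that assms(1,4) U by (auto simp: is_seq_def)
    then have "\<not> oddfree X False (to_core \<psi>)"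
      using assms(4) oddfree_PMu[of X False Z \<psi>] by (auto simp: positive_in_def)
    then show ?thesis
      using X U by (auto simp: positive_in_def oddfree_psubst)
  qed
  ultimately show ?thesis
    using is_deflist_snoc[OF assms(1,2)] U by (auto simp: is_seq_def ddom_snoc)
qed

text \<open>The instance of \<open>C\<close> used in \<open>ex_good\<close>: each definition of
  \<open>\<Delta>\<close> has its companion node, whose list is the prefix ending in that
  definition.\<close>

definition prefixes_of :: "'a deflist \<Rightarrow> 'a deflist set" where
  "prefixes_of \<Delta> = {\<Delta>1. \<Delta>1 \<noteq> [] \<and> (\<exists>\<Delta>2. \<Delta> = \<Delta>1 @ \<Delta>2)}"

lemma prefixes_of_snoc: "prefixes_of (\<Delta> @ [d]) = insert (\<Delta> @ [d]) (prefixes_of \<Delta>)"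
proof -
  have "(\<exists>\<Delta>2. \<Delta> @ [d] = \<Delta>1 @ \<Delta>2) \<longleftrightarrow> \<Delta>1 = \<Delta> @ [d] \<or> (\<exists>\<Delta>2. \<Delta> = \<Delta>1 @ \<Delta>2)" for \<Delta>1
  proof
    assume "\<exists>\<Delta>2. \<Delta> @ [d] = \<Delta>1 @ \<Delta>2"
    then obtain \<Delta>2 where "\<Delta> @ [d] = \<Delta>1 @ \<Delta>2" by (rule exE)
    then show "\<Delta>1 = \<Delta> @ [d] \<or> (\<exists>\<Delta>2. \<Delta> = \<Delta>1 @ \<Delta>2)"
      by (cases \<Delta>2 rule: rev_cases) auto
  qed auto
  then show ?thesis by (auto simp: prefixes_of_def)
qed

lemma newest_prefixes_of: "newest ` prefixes_of \<Delta> = ddom \<Delta>"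
proof (induction \<Delta> rule: rev_induct)
  case (snoc d \<Delta>)
  then show ?case by (simp add: prefixes_of_snoc) (simp add: ddom_def)
qed (auto simp: prefixes_of_def ddom_def)

text \<open>Puts \<open>RSig\<close>, \<open>RThin\<close> and \<open>RUn\<close> on top of a tree
  for the unfolded body.\<close>

lemma good_fix:
  assumes seq: "is_seq (S, \<Delta>, \<phi>)" and wf: "wf_form (to_core \<phi>)" and S: "S \<subseteq> ext \<Delta> \<phi>"
    and fix_form: "\<phi> = PNu Z \<psi> \<or> \<phi> = PMu Z \<psi>"
    and U: "fresh U \<Delta> \<phi>"
    and \<Delta>': "\<Delta>' = \<Delta> @ [(U, \<phi>)]"
    and t: "good (prefixes_of \<Delta>') t" "label t = (ext \<Delta>' (PVar U), \<Delta>', psubst Z U \<psi>)"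
  shows "\<exists>t. good (prefixes_of \<Delta>) t \<and> label t = (S, \<Delta>, \<phi>)"
proof -
  let ?S = "ext \<Delta>' (PVar U)"
  let ?un = "Inner (?S, \<Delta>', PVar U) RUn [t]"
  let ?thin = "Inner (S, \<Delta>', PVar U) RThin [?un]"
  let ?sig = "Inner (S, \<Delta>, \<phi>) RSig [?thin]"
  have Un: "U \<notin> ddom \<Delta>" "U \<notin> allv \<phi>"
    using U by (auto simp: fresh_def)
  have seq': "is_seq (X, \<Delta>', PVar U)" for X
    using is_deflist_snoc[OF seq U] by (auto simp: is_seq_def positive_in_def \<Delta>')
  have "map_of \<Delta>' U = Some \<phi>"
    using Un by (auto simp: \<Delta>' map_add_Some_iff ddom_def map_of_eq_None_iff)
  \<comment> \<open>The only rule application that must decrease strictly, and only for a least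
    fixed point.\<close>
  moreover have "descends (?S, \<Delta>', PVar U) RUn (?S, \<Delta>', psubst Z U \<psi>)"
  proof -
    have "(take (length \<Delta>') (sig \<Delta>' (psubst Z U \<psi>) s), sig \<Delta>' (PVar U) s)
        \<in> (if is_mu \<phi> then sig_less else sig_less\<^sup>=)" if s: "s \<in> ?S" for s
    proof -
      have h: "holds \<Delta>' (PVar U) s (sig \<Delta>' (PVar U) s)" using s by (rule holds_sig)
      show ?thesis
      proof (cases "is_mu \<phi>")
        case True
        then have \<phi>: "\<phi> = PMu Z \<psi>" using fix_form by (auto simp: is_mu_def)
        obtain ys where ys: "holds \<Delta>' (psubst Z U \<psi>) s ys" "(ys, sig \<Delta>' (PVar U) s) \<in> sig_less"
          using holds_unfold_Mu[of U Z \<psi> \<Delta>] h Un by (auto simp: \<Delta>' \<phi>)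
        then have "s \<in> ext \<Delta>' (psubst Z U \<psi>)" by (auto simp: ext_def)
        then show ?thesis
          using sig_le_trans(2)[OF sig_least[OF ys(1)] ys(2)] True by (simp add: length_sig)
      next
        case False
        then have \<phi>: "\<phi> = PNu Z \<psi>" using fix_form by (auto simp: is_mu_def)
        have h': "holds \<Delta>' (psubst Z U \<psi>) s (sig \<Delta>' (PVar U) s)"
          using holds_unfold_Nu[of Z \<psi> U \<Delta>] h Un wf by (auto simp: \<Delta>' \<phi>)
        then have "s \<in> ext \<Delta>' (psubst Z U \<psi>)" by (auto simp: ext_def)
        then show ?thesis
          using sig_least[OF h'] False by (simp add: length_sig)
      qed
    qed
    then show ?thesis by (auto simp: local_step_def \<Delta>')
  qed
  moreover have "U \<notin> newest ` prefixes_of \<Delta>"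
    using Un by (simp add: newest_prefixes_of)
  ultimately have un: "good (prefixes_of \<Delta>) ?un"
    using t seq' fix_form
    by (intro good_Inner) (auto simp: \<Delta>' prefixes_of_snoc)
  \<comment> \<open>Appending the rank of a closed stage to the signature of \<open>s\<close> serves
    both the inclusion needed for \<open>RThin\<close> and the descent at
    \<open>RSig\<close>.\<close>
  have ex: "\<exists>ys. holds \<Delta>' (PVar U) s ys \<and> take (length \<Delta>) ys = sig \<Delta> \<phi> s \<and> length ys = length \<Delta>'"
    if s: "s \<in> S" for s
  proof -
    have h: "holds \<Delta> \<phi> s (sig \<Delta> \<phi> s)" using s S holds_sig by auto
    obtain a where "holds \<Delta>' (PVar U) s (sig \<Delta> \<phi> s @ [a])"
      using holds_fix[OF h] \<Delta>' by blast
    then show ?thesis using h by (intro exI[of _ "sig \<Delta> \<phi> s @ [a]"]) (auto simp: holds_def)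
  qed
  then have S': "S \<subseteq> ?S" by (auto simp: ext_def)
  have "descends (S, \<Delta>', PVar U) RThin (?S, \<Delta>', PVar U)"
    using S' by (intro descends_same_deflist) (auto simp: local_step_def holds_sig)
  then have thin: "good (prefixes_of \<Delta>) ?thin"
    using un seq' S' by (intro good_Inner) auto
  have "descends (S, \<Delta>, \<phi>) RSig (S, \<Delta>', PVar U)"
  proof -
    have "(take (length \<Delta>) (sig \<Delta>' (PVar U) s), sig \<Delta> \<phi> s) \<in> sig_less\<^sup>=" if s: "s \<in> S" for s
    proof -
      obtain ys where ys: "holds \<Delta>' (PVar U) s ys" "take (length \<Delta>) ys = sig \<Delta> \<phi> s"
        "length ys = length \<Delta>'" using ex[OF s] by blast
      have "length (sig \<Delta>' (PVar U) s) = length ys"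
        using s S' ys by (auto simp: length_sig)
      then show ?thesis using sig_less_take[OF sig_least[OF ys(1)]] ys(2) by metis
    qed
    then show ?thesis by (auto simp: local_step_def \<Delta>')
  qed
  then have "good (prefixes_of \<Delta>) ?sig"
    using thin seq S fix_form U by (intro good_Inner) (auto simp: is_fix_def \<Delta>')
  then show ?thesis by (intro exI[of _ ?sig]) auto
qed

text \<open>The induction is on size, not structure: the recursive call for a fixed point is on its
  body with \<open>U\<close> for \<open>Z\<close>, which has the size of the body.\<close>

lemma ex_good:
  assumes "is_seq (S, \<Delta>, \<phi>)" "wf_form (to_core \<phi>)" "S \<subseteq> ext \<Delta> \<phi>"
  shows "\<exists>t. good (prefixes_of \<Delta>) t \<and> label t = (S, \<Delta>, \<phi>)"
  using assms
proof (induction "size \<phi>" arbitrary: S \<Delta> \<phi> rule: less_induct)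
  case less
  note seq = less.prems(1) and wf = less.prems(2) and S = less.prems(3)
  have fix_case: ?case if "\<phi> = PNu Z \<psi> \<or> \<phi> = PMu Z \<psi>" for Z \<psi>
  proof -
    obtain U where U: "fresh U \<Delta> \<phi>" using ex_fresh by blast
    let ?\<Delta> = "\<Delta> @ [(U, \<phi>)]"
    have Ua: "U \<notin> allv \<phi>" using U by (auto simp: fresh_def)
    have "wf_form (to_core \<psi>)" using wf that wf_form_PMu[of Z \<psi>] by auto
    then have "wf_form (to_core (psubst Z U \<psi>))"
      using Ua that by (auto intro: wf_form_psubst)
    \<comment> \<open>The companion node passes its full extension on to the unfolded body.\<close>
    moreover have "ext ?\<Delta> (PVar U) \<subseteq> ext ?\<Delta> (psubst Z U \<psi>)"
      using that holds_unfold_Mu[of U Z \<psi> \<Delta>] holds_unfold_Nu[of Z \<psi> U \<Delta>] Ua wf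
      unfolding ext_def by blast
    moreover have "is_seq (ext ?\<Delta> (PVar U), ?\<Delta>, psubst Z U \<psi>)"
      using is_seq_unfold[OF seq U wf that] .
    moreover have "size (psubst Z U \<psi>) < size \<phi>"
      using that by auto
    ultimately obtain t where "good (prefixes_of ?\<Delta>) t"
      "label t = (ext ?\<Delta> (PVar U), ?\<Delta>, psubst Z U \<psi>)"
      using less.hyps by blast
    then show ?thesis using good_fix[OF seq wf S that U refl] by blast
  qed
  have leaf_case: ?case if "\<phi> = PVar Z \<or> \<phi> = PNVar Z" for Z
  proof -
    have "\<exists>\<Delta>1 \<in> prefixes_of \<Delta>. \<Delta>1 \<noteq> [] \<and> newest \<Delta>1 = Z \<and> (\<exists>\<Delta>2. \<Delta> = \<Delta>1 @ \<Delta>2)"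
      if "Z \<in> ddom \<Delta>"
      using that unfolding newest_prefixes_of[symmetric] by (auto simp: prefixes_of_def)
    then have "good (prefixes_of \<Delta>) (Leaf (S, \<Delta>, \<phi>))"
      using seq S that by (intro good_Leaf)
    then show ?thesis by (intro exI[of _ "Leaf (S, \<Delta>, \<phi>)"]) auto
  qed
  have sig: "s \<in> S \<Longrightarrow> holds \<Delta> \<phi> s (sig \<Delta> \<phi> s)" for s
    using S holds_sig by auto
  show ?case
  proof (cases \<phi>)
    case (PAnd \<phi>1 \<phi>2)
    have "S \<subseteq> ext \<Delta> \<phi>1" "S \<subseteq> ext \<Delta> \<phi>2"
      using S by (auto simp: ext_def PAnd holds_connectives)
    then obtain t1 t2 where t: "good (prefixes_of \<Delta>) t1" "label t1 = (S, \<Delta>, \<phi>1)"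
        "good (prefixes_of \<Delta>) t2" "label t2 = (S, \<Delta>, \<phi>2)"
      using less.hyps[of \<phi>1 S \<Delta>] less.hyps[of \<phi>2 S \<Delta>] is_seq_subformulas(1)[of S \<Delta> \<phi>1 \<phi>2 S] seq wf PAnd by auto
    have "descends (S, \<Delta>, \<phi>) RAnd (S, \<Delta>, \<phi>1)" "descends (S, \<Delta>, \<phi>) RAnd (S, \<Delta>, \<phi>2)"
      using S sig by (auto simp: local_step_def PAnd holds_connectives simp del: descends.simps
          intro!: descends_same_deflist)
    then have "good (prefixes_of \<Delta>) (Inner (S, \<Delta>, \<phi>) RAnd [t1, t2])"
      using seq S t by (intro good_Inner) (auto simp: PAnd)
    then show ?thesis by (metis label.simps(2))
  next
    case (POr \<phi>1 \<phi>2)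
    \<comment> \<open>Each state goes to the disjuncts that hold at its own signature, possibly to
      both.\<close>
    define S1 where "S1 = {s \<in> S. holds \<Delta> \<phi>1 s (sig \<Delta> \<phi> s)}"
    define S2 where "S2 = {s \<in> S. holds \<Delta> \<phi>2 s (sig \<Delta> \<phi> s)}"
    have SS: "S = S1 \<union> S2"
      using sig by (auto simp: S1_def S2_def POr holds_connectives)
    have "S1 \<subseteq> ext \<Delta> \<phi>1" "S2 \<subseteq> ext \<Delta> \<phi>2"
      by (auto simp: ext_def S1_def S2_def)
    then obtain t1 t2 where t: "good (prefixes_of \<Delta>) t1" "label t1 = (S1, \<Delta>, \<phi>1)"
        "good (prefixes_of \<Delta>) t2" "label t2 = (S2, \<Delta>, \<phi>2)"
      using less.hyps[of \<phi>1 S1 \<Delta>] less.hyps[of \<phi>2 S2 \<Delta>] is_seq_subformulas(2)[of S \<Delta> \<phi>1 \<phi>2 S1]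
        is_seq_subformulas(2)[of S \<Delta> \<phi>1 \<phi>2 S2] seq wf POr by auto
    have "descends (S, \<Delta>, \<phi>) ROr (S1, \<Delta>, \<phi>1)" "descends (S, \<Delta>, \<phi>) ROr (S2, \<Delta>, \<phi>2)"
      using S by (auto simp: local_step_def S1_def S2_def simp del: descends.simps
          intro!: descends_same_deflist)
    then have "good (prefixes_of \<Delta>) (Inner (S, \<Delta>, \<phi>) ROr [t1, t2])"
      using seq S t SS by (intro good_Inner) (auto simp: POr)
    then show ?thesis by (metis label.simps(2))
  next
    case (PBox K \<psi>)
    let ?S = "{s'. \<exists>s \<in> S. kstep T s K s'}"
    have "?S \<subseteq> ext \<Delta> \<psi>"
      using sig by (auto simp: ext_def PBox holds_connectives)
    then obtain t where t: "good (prefixes_of \<Delta>) t" "label t = (?S, \<Delta>, \<psi>)"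
      using less.hyps[of \<psi> ?S \<Delta>] is_seq_subformulas(3)[of S \<Delta> K \<psi> ?S] seq wf PBox by auto
    have "descends (S, \<Delta>, \<phi>) RBox (?S, \<Delta>, \<psi>)"
      using S sig by (intro descends_same_deflist) (auto simp: local_step_def PBox holds_connectives)
    then have "good (prefixes_of \<Delta>) (Inner (S, \<Delta>, \<phi>) RBox [t])"
      using seq S t by (intro good_Inner) (auto simp: PBox)
    then show ?thesis by (metis label.simps(2))
  next
    case (PDia K \<psi>)
    \<comment> \<open>The witness is a successor at which the signature of \<open>s\<close> is still
      admissible, not merely one satisfying the body.\<close>
    have "\<forall>s \<in> S. \<exists>s'. kstep T s K s' \<and> holds \<Delta> \<psi> s' (sig \<Delta> \<phi> s)"
      using sig by (auto simp: PDia holds_connectives)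
    then obtain f where f: "\<And>s. s \<in> S \<Longrightarrow> kstep T s K (f s) \<and> holds \<Delta> \<psi> (f s) (sig \<Delta> \<phi> s)"
      by metis
    then have "f ` S \<subseteq> ext \<Delta> \<psi>"
      by (auto simp: ext_def)
    then obtain t where t: "good (prefixes_of \<Delta>) t" "label t = (f ` S, \<Delta>, \<psi>)"
      using less.hyps[of \<psi> "f ` S" \<Delta>] is_seq_subformulas(4)[of S \<Delta> K \<psi> "f ` S"] seq wf PDia by auto
    have "descends (S, \<Delta>, \<phi>) (RDia f) (f ` S, \<Delta>, \<psi>)"
      using S f by (intro descends_same_deflist) (auto simp: local_step_def)
    then have "good (prefixes_of \<Delta>) (Inner (S, \<Delta>, \<phi>) (RDia f) [t])"
      using seq S t f by (intro good_Inner) (auto simp: PDia)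
    then show ?thesis by (metis label.simps(2))
  qed (use leaf_case fix_case in blast)+
qed

text \<open>Below the root \<open>C\<close> grows by exactly the companion nodes passed on the path;
  \<open>C\<close> is arbitrary for the induction along it.\<close>

lemma good_subt:
  assumes "good C t" "valid t p"
  shows "good (C \<union> {dl t m | m. companion t m \<and> sprefix m p}) (subt t p)"
  using assms
proof (induction p arbitrary: C t)
  case Nil
  then show ?case by (simp add: sprefix_def)
next
  case (Cons i p)
  from Cons.prems show ?case
  proof (cases rule: good.cases)
    case (good_Inner S \<Delta> \<phi> r ts)
    let ?C = "if r = RUn then insert \<Delta> C else C"
    have i: "i < length ts" and v: "valid (ts ! i) p"
      using Cons.prems good_Inner by auto
    have "good (?C \<union> {dl (ts ! i) m | m. companion (ts ! i) m \<and> sprefix m p}) (subt (ts ! i) p)"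
      using Cons.IH[of ?C "ts ! i"] good_Inner i v by auto
    moreover have "{dl t m | m. companion t m \<and> sprefix m (i # p)}
      = (if r = RUn then {\<Delta>} else {}) \<union> {dl (ts ! i) m | m. companion (ts ! i) m \<and> sprefix m p}"
      (is "?A = ?B")
    proof -
      have sp: "sprefix m (i # p) \<longleftrightarrow> m = [] \<or> (\<exists>m'. m = i # m' \<and> sprefix m' p)" for m
        by (cases m) (auto simp: sprefix_def)
      have c: "companion t [] \<longleftrightarrow> r = RUn" "dl t [] = \<Delta>"
        "companion t (i # m) \<longleftrightarrow> companion (ts ! i) m" "dl t (i # m) = dl (ts ! i) m" for m
        using good_Inner(1) i by (auto simp: companion_def dl_def)
      have "{dl t m | m. companion t m \<and> sprefix m (i # p)}
        = {dl t m | m. companion t m \<and> m = []}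
          \<union> {dl t (i # m) | m. companion t (i # m) \<and> sprefix m p}"
        unfolding sp by blast
      then show ?thesis by (simp add: c)
    qed
    ultimately show ?thesis
      using good_Inner(1) by (auto simp: insert_commute split: if_splits)
  qed simp
qed

section \<open>Well-foundedness of the companion orders\<close>

context
  fixes t :: "('s,'a) tree"
  assumes good: "good {} t" and root: "dl t [] = []"
begin

abbreviation sg :: "nat list \<Rightarrow> 's \<Rightarrow> 's set list" where
  "sg n \<equiv> sig (dl t n) (fm t n)"

definition mu_node :: "nat list \<Rightarrow> bool" where
  "mu_node n \<longleftrightarrow> companion t n \<and> is_mu (snd (last (dl t n)))"

lemma good_node: "valid t n \<Longrightarrow> good {dl t m | m. companion t m \<and> sprefix m n} (subt t n)"
  using good_subt[OF good] by simp

lemma label_eq: "label (subt t n) = (sts t n, dl t n, fm t n)"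
  by (simp add: sts_def dl_def fm_def)

lemma is_seq_node: "valid t n \<Longrightarrow> is_seq (sts t n, dl t n, fm t n)"
  and sts_subset_ext: "valid t n \<Longrightarrow> sts t n \<subseteq> ext (dl t n) (fm t n)"
  using good_node[of n] by (auto simp: sts_def dl_def fm_def elim!: good.cases)

lemma distinct_node: "valid t n \<Longrightarrow> distinct (map fst (dl t n))"
  using is_seq_node by (auto simp: is_seq_def is_deflist_def)

lemma length_sg: "valid t n \<Longrightarrow> s \<in> sts t n \<Longrightarrow> length (sg n s) = length (dl t n)"
  using sts_subset_ext length_sig by blast

text \<open>The last fact says that nested companion nodes unfold different constants; it makes the
  companion of a leaf unique.\<close>

lemma companion_node:
  assumes "companion t n"
  shows "dl t n \<noteq> []" "fm t n = PVar (newest (dl t n))" "sts t n = ext (dl t n) (fm t n)"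
    and "companion t m \<Longrightarrow> sprefix m n \<Longrightarrow> newest (dl t m) \<noteq> newest (dl t n)"
proof -
  have v: "valid t n" and r: "rule_of (subt t n) = Some RUn"
    using assms by (auto simp: companion_def)
  from good_node[OF v]
  have *: "dl t n \<noteq> [] \<and> fm t n = PVar (newest (dl t n)) \<and> sts t n = ext (dl t n) (fm t n) \<and>
    newest (dl t n) \<notin> newest ` {dl t m | m. companion t m \<and> sprefix m n}"
  proof (cases rule: good.cases)
    case (good_Inner S \<Delta> \<phi> r' ts)
    then have eq: "sts t n = S" "dl t n = \<Delta>" "fm t n = \<phi>" and "r' = RUn"
      using r by (auto simp: sts_def dl_def fm_def)
    show ?thesis unfolding eq by (rule good_Inner) fact
  qed (use r in simp)
  then show "dl t n \<noteq> []" "fm t n = PVar (newest (dl t n))" "sts t n = ext (dl t n) (fm t n)"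
    by blast+
  show "newest (dl t m) \<noteq> newest (dl t n)" if "companion t m" "sprefix m n"
  proof
    assume "newest (dl t m) = newest (dl t n)"
    then have "newest (dl t n) \<in> newest ` {dl t m | m. companion t m \<and> sprefix m n}"
      using that by (metis (mono_tags, lifting) imageI mem_Collect_eq)
    then show False using * by blast
  qed
qed

lemma subt_append: "subt t (p @ q) = subt (subt t p) q"
  by (induction p arbitrary: t) auto

lemma valid_append: "valid t (p @ q) \<longleftrightarrow> valid t p \<and> valid (subt t p) q"
  by (induction p arbitrary: t) auto

lemma lt_step_descends:
  assumes "lt_step T t n' s' n s"
  shows "valid t n" "valid t n'" "s \<in> sts t n" "s' \<in> sts t n'"
    and "\<exists>\<Delta>'. dl t n' = dl t n @ \<Delta>'"
    and "(take (length (dl t n)) (sg n' s'), sg n s)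
           \<in> (if mu_node n then sig_less else sig_less\<^sup>=)"
proof -
  obtain i where n': "n' = n @ [i]" and v: "valid t n'" and l: "s \<in> sts t n" "s' \<in> sts t n'"
    using assms by (auto simp: lt_step_def is_child_def)
  then have vn: "valid t n" and i: "i < length (children (subt t n))"
    by (auto simp: valid_append)
  show "valid t n" "valid t n'" "s \<in> sts t n" "s' \<in> sts t n'" by fact+
  from good_node[OF vn] i obtain r ts where t: "subt t n = Inner (sts t n, dl t n, fm t n) r ts"
    and d: "\<And>t'. t' \<in> set ts \<Longrightarrow> descends (sts t n, dl t n, fm t n) r (label t')"
    using label_eq[of n] by (auto elim!: good.cases)
  have "label (ts ! i) = (sts t n', dl t n', fm t n')"
    using label_eq[of n'] t by (simp add: n' subt_append)
  then have D: "descends (sts t n, dl t n, fm t n) r (sts t n', dl t n', fm t n')"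
    using d[of "ts ! i"] i t by auto
  then show "\<exists>\<Delta>'. dl t n' = dl t n @ \<Delta>'" by simp
  have "local_step (sts t n, dl t n, fm t n) r (sts t n', dl t n', fm t n') s' s"
    using assms t by (simp add: local_step_def lt_step_def split: rule.splits)
  moreover have "mu_node n \<longleftrightarrow> r = RUn \<and> is_mu (snd (last (dl t n)))"
    using t vn by (auto simp: mu_node_def companion_def)
  ultimately show "(take (length (dl t n)) (sg n' s'), sg n s)
      \<in> (if mu_node n then sig_less else sig_less\<^sup>=)"
    using D by simp
qed

text \<open>A nonempty path starts with the rule at \<open>n\<close>, so it is strict when that rule
  unfolds a least fixed point; the empty path is not.\<close>

definition leads :: "nat list \<Rightarrow> 's \<Rightarrow> nat list \<Rightarrow> 's \<Rightarrow> bool" where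
  "leads n' s' n s \<longleftrightarrow> valid t n \<and> valid t n' \<and> s \<in> sts t n \<and> s' \<in> sts t n' \<and>
     (\<exists>\<Delta>'. dl t n' = dl t n @ \<Delta>') \<and>
     (take (length (dl t n)) (sg n' s'), sg n s)
       \<in> (if n' \<noteq> n \<and> mu_node n then sig_less else sig_less\<^sup>=)"

lemma take_sg_trans:
  assumes "(take (length (dl t m)) xs, sg m u) \<in> sig_less\<^sup>=" "dl t m = dl t n @ \<Delta>'"
    and "valid t m" "u \<in> sts t m" "length (dl t m) \<le> length xs"
  shows "(take (length (dl t n)) xs, take (length (dl t n)) (sg m u)) \<in> sig_less\<^sup>="
proof -
  have "take (length (dl t n)) (take (length (dl t m)) xs) = take (length (dl t n)) xs"
    using assms(2) by (simp add: min_def)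
  moreover have "length (take (length (dl t m)) xs) = length (sg m u)"
    using assms(3-5) length_sg by simp
  ultimately show ?thesis
    using sig_less_take[OF assms(1), of "length (dl t n)"] by metis
qed

text \<open>In a composition, strictness can only come from the upper part: below \<open>m\<close> a strict
  decrease need not show in the ranks that count at \<open>n\<close>.\<close>

lemma leads_trans:
  assumes "leads n' s' m u'" "(sg m u', sg m u) \<in> sig_less\<^sup>=" "leads m u n s"
    and "n' \<noteq> n \<Longrightarrow> m \<noteq> n \<or> \<not> mu_node n"
  shows "leads n' s' n s"
proof -
  obtain \<Delta>1 \<Delta>2 where \<Delta>: "dl t n' = dl t m @ \<Delta>1" "dl t m = dl t n @ \<Delta>2"
    using assms(1,3) by (auto simp: leads_def)
  have v: "valid t n'" "valid t m" "s' \<in> sts t n'" "u \<in> sts t m"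
    using assms(1,3) by (auto simp: leads_def)
  have "(take (length (dl t m)) (sg n' s'), sg m u') \<in> sig_less\<^sup>="
    using assms(1) by (auto simp: leads_def split: if_splits)
  then have "(take (length (dl t m)) (sg n' s'), sg m u) \<in> sig_less\<^sup>="
    using assms(2) sig_le_trans(1) by blast
  then have *: "(take (length (dl t n)) (sg n' s'), take (length (dl t n)) (sg m u)) \<in> sig_less\<^sup>="
    using \<Delta>(2) v(2,4)
  proof (rule take_sg_trans)
    show "length (dl t m) \<le> length (sg n' s')"
      unfolding length_sg[OF v(1,3)] unfolding \<Delta>(1) by simp
  qed
  show ?thesis
  proof (cases "n' \<noteq> n \<and> mu_node n")
    case True
    \<comment> \<open>The last assumption gives \<open>m \<noteq> n\<close> here, so the upper part
      is itself strict.\<close>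
    then have "(take (length (dl t n)) (sg m u), sg n s) \<in> sig_less"
      using assms(3,4) by (auto simp: leads_def split: if_splits)
    then show ?thesis
      using sig_le_trans(2)[OF *] True assms(1,3) \<Delta> unfolding leads_def by auto
  next
    case False
    have "(take (length (dl t n)) (sg m u), sg n s) \<in> sig_less\<^sup>="
      using assms(3) by (auto simp: leads_def split: if_splits)
    then show ?thesis
      using sig_le_trans(1)[OF *] False assms(1,3) \<Delta> unfolding leads_def by auto
  qed
qed

lemma lt_step_leads: "lt_step T t n' s' n s \<Longrightarrow> leads n' s' n s"
  using lt_step_descends[of n' s' n s] by (auto simp: leads_def split: if_splits)

lemma dlt_leads: "dlt T t n' s' n s \<Longrightarrow> leads n' s' n s"
proof (induction rule: dlt.induct)
  case (dlt_refl n s)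
  then show ?case by (simp add: leads_def length_sg)
next
  case (dlt_step n' s' m s'' n s)
  \<comment> \<open>\<open>dlt\<close> splits off its uppermost step, which supplies the strictness
    at \<open>n\<close>.\<close>
  have "m \<noteq> n" using dlt_step.hyps(2) by (auto simp: lt_step_def is_child_def)
  then show ?case
    using leads_trans[OF dlt_step.IH _ lt_step_leads[OF dlt_step.hyps(2)]] by simp
qed

lemma comp_leafD: "comp_leaf t m n \<Longrightarrow> cl_cand t m n"
  unfolding comp_leaf_def by (cases "length n") auto

text \<open>Closes the loop: leaf and companion share the constant, so the truncated signature of
  the leaf is admissible at the companion, whose signature is least.\<close>

lemma sg_companion_leaf:
  assumes "comp_leaf t m m'" "dl t m' = dl t m @ \<Delta>'" "s \<in> sts t m'"
  shows "(sg m s, take (length (dl t m)) (sg m' s)) \<in> sig_less\<^sup>="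
proof -
  have c: "companion t m" "fm t m' = fm t m" "valid t m'"
    using comp_leafD[OF assms(1)] by (auto simp: cl_cand_def is_leaf_def)
  have "newest (dl t m) \<in> ddom (dl t m)"
    using companion_node(1)[OF c(1)] by (simp add: ddom_def)
  then have "newest (dl t m) \<notin> ddom \<Delta>'"
    using distinct_node[OF c(3)] assms(2) by (auto simp: ddom_def)
  moreover have "holds (dl t m') (fm t m') s (sg m' s)"
    using holds_sig sts_subset_ext[OF c(3)] assms(3) by blast
  ultimately show ?thesis
    using companion_node(2)[OF c(1)] c(2) assms(2) holds_PVar_append sig_least by simp
qed

text \<open>Both relations need simultaneous induction, as \<open>cnn\<close> may run through loops
  at lower companion nodes.\<close>

lemma cm_descends:
  shows "cm T t m s' s \<Longrightarrow> (sg m s', sg m s) \<in> (if mu_node m then sig_less else sig_less\<^sup>=)"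
    and "cnn T t n' s' n s \<Longrightarrow> leads n' s' n s"
proof (induction rule: cm_cnn.inducts)
  case (cm_intro m m' s' s)
  obtain \<Delta>' where \<Delta>': "dl t m' = dl t m @ \<Delta>'"
    using cm_intro by (auto simp: leads_def)
  \<comment> \<open>The leaf lies strictly below \<open>m\<close>, so \<open>leads\<close> is strict
    if \<open>m\<close> is a \<open>mu_node\<close>.\<close>
  have "m' \<noteq> m"
    using comp_leafD[OF cm_intro(1)] by (auto simp: cl_cand_def sprefix_def)
  then have "(take (length (dl t m)) (sg m' s'), sg m s)
      \<in> (if mu_node m then sig_less else sig_less\<^sup>=)"
    using cm_intro by (auto simp: leads_def)
  then show ?case
    using sig_le_trans[OF sg_companion_leaf[OF cm_intro(1) \<Delta>' cm_intro(2)]]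
    by (cases "mu_node m") simp_all
next
  case (cnn_base s' n' s n)
  then show ?case using dlt_leads by blast
next
  case (cnn_comp s' n' s n m u' u)
  \<comment> \<open>The induction hypothesis sits inside the transitive closure; it is extracted
    link by link, and weak descent is enough.\<close>
  let ?R = "\<lambda>s' s. cm T t m s' s \<and> (sg m s', sg m s) \<in> (if mu_node m then sig_less else sig_less\<^sup>=)"
  have "?R\<^sup>+\<^sup>+ u' u" using cnn_comp by simp
  then have "(sg m u', sg m u) \<in> sig_less\<^sup>="
  proof (induction rule: tranclp_induct)
    case (base y)
    then show ?case by (auto split: if_splits)
  next
    case (step y z)
    then have "(sg m y, sg m z) \<in> sig_less\<^sup>=" by (auto split: if_splits)
    then show ?case using step.IH sig_le_trans(1) by blast
  qed
  then show ?case
    using leads_trans[of n' s' m u' u n s] cnn_comp dlt_leads by blast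
qed

lemma wfP_cm: "mu_node m \<Longrightarrow> wfP (cm T t m)"
proof -
  assume "mu_node m"
  then have "{(s', s). cm T t m s' s} \<subseteq> inv_image sig_less (sg m)"
    using cm_descends(1) by fastforce
  then show "wfP (cm T t m)"
    unfolding wfp_def using wf_subset[OF wf_inv_image[OF wf_sig_less]] by blast
qed

section \<open>Leaves and success of the constructed tree\<close>

text \<open>Leaves are literals, so diamond leaves never arise; a defined constant finds its
  companion in the recorded set.\<close>

lemma leaf_cases:
  assumes "is_leaf t n"
  obtains Z where "fm t n = PVar Z" "Z \<notin> ddom (dl t n)" "sts t n \<subseteq> V Z"
  | Z where "fm t n = PNVar Z" "Z \<notin> ddom (dl t n)" "sts t n \<inter> V Z = {}"
  | U m \<Delta>' where "fm t n = PVar U" "U \<in> ddom (dl t n)" "comp_leaf t m n" "fm t m = PVar U"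
      "dl t n = dl t m @ \<Delta>'"
proof -
  have v: "valid t n" using assms by (simp add: is_leaf_def)
  have seq: "is_seq (sts t n, dl t n, fm t n)" and S: "sts t n \<subseteq> ext (dl t n) (fm t n)"
    using is_seq_node sts_subset_ext v by auto
  obtain Z where Z: "fm t n = PVar Z \<or> fm t n = PNVar Z"
    and C: "Z \<in> ddom (dl t n) \<Longrightarrow> \<exists>m. companion t m \<and> sprefix m n \<and> dl t m \<noteq> [] \<and>
      newest (dl t m) = Z \<and> (\<exists>\<Delta>'. dl t n = dl t m @ \<Delta>')"
    using good_node[OF v] assms by (fastforce simp: is_leaf_def dl_def fm_def elim!: good.cases)
  show thesis
  proof (cases "Z \<in> ddom (dl t n)")
    case False
    then have *: "s \<in> (if fm t n = PVar Z then V Z else - V Z)" if "s \<in> sts t n" for s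
      using that S Z by (auto simp: ext_def holds_def psem_simps dval_other)
    show thesis
    proof (cases "fm t n = PVar Z")
      case True
      then show thesis using that(1)[of Z] False * by auto
    next
      case F: False
      then show thesis using that(2)[of Z] False * Z by auto
    qed
  next
    case True
    then obtain m \<Delta>' where m: "companion t m" "sprefix m n" "dl t m \<noteq> []" "newest (dl t m) = Z"
      "dl t n = dl t m @ \<Delta>'" using C by blast
    \<comment> \<open>Defined constants occur only positively in a sequent, which excludes
      \<open>PNVar\<close>.\<close>
    have f: "fm t n = PVar Z"
      using Z seq True by (auto simp: is_seq_def positive_in_def)
    have fm: "fm t m = PVar Z" using companion_node(2) m by auto
    have "Z \<in> ddom (dl t m)" using m by (auto simp: ddom_def)
    then have "Z \<notin> ddom \<Delta>'" using m(5) distinct_node[OF v] by (auto simp: ddom_def)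
    \<comment> \<open>The companion carries the full extension of \<open>Z\<close>, and the leaf's
      later definitions do not affect \<open>Z\<close>.\<close>
    then have "sts t n \<subseteq> sts t m"
      using S holds_PVar_append[of "dl t m" \<Delta>' Z]
      unfolding companion_node(3)[OF m(1)] f fm m(5) ext_def by blast
    then have cand: "cl_cand t m n"
      using m assms f fm by (auto simp: cl_cand_def)
    \<comment> \<open>No companion node below \<open>m\<close> can claim the leaf, since it unfolds
      another constant.\<close>
    have "\<not> cleaf_upto k t m' n" if "companion t m'" "sprefix m m'" for k m'
    proof -
      have "newest (dl t m') \<noteq> Z" using companion_node(4) m that by blast
      then have "\<not> cl_cand t m' n"
        using companion_node(2)[OF that(1)] f by (auto simp: cl_cand_def)
      then show ?thesis by (cases k) auto
    qed
    \<comment> \<open>A strict prefix makes \<open>n\<close> nonempty, so the bounded recursion is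
      not in its zero case.\<close>
    moreover obtain k where "length n = Suc k"
      using m(2) by (auto simp: sprefix_def neq_Nil_conv)
    ultimately have "comp_leaf t m n"
      using cand unfolding comp_leaf_def by auto
    then show thesis using that(3) f True fm m(5) by blast
  qed
qed

lemma partial_tableau_good: "partial_tableau T t"
  unfolding partial_tableau_def
proof (intro allI impI conjI)
  fix p assume v: "valid t p"
  show "is_seq (label (subt t p))" using is_seq_node[OF v] label_eq by simp
  show "case subt t p of Leaf q \<Rightarrow> True | Inner q r ts \<Rightarrow> rule_inst T r q (map label ts)"
    using good_node[OF v] by (auto elim!: good.cases)
qed

lemma good_successful: "successful_tableau T V t"
proof -
  have "terminal T t n \<and> successful_leaf T V t n" if leaf: "is_leaf t n" for n
  proof (cases rule: leaf_cases[OF leaf])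
    case (1 Z)
    then show ?thesis by (auto simp: terminal_def successful_leaf_def)
  next
    case (2 Z)
    then show ?thesis by (auto simp: terminal_def successful_leaf_def)
  next
    case (3 U m \<Delta>')
    have m: "companion t m" "sprefix m n" "sts t n \<subseteq> sts t m"
      using comp_leafD[OF 3(3)] by (auto simp: cl_cand_def)
    then have s: "sigma_leaf t n U"
      using 3 leaf by (auto simp: sigma_leaf_def)
    have v: "valid t n" "valid t m" using leaf m by (auto simp: is_leaf_def companion_def)
    obtain \<theta> where \<theta>: "last (dl t m) = (U, \<theta>)"
      using companion_node(2)[OF m(1)] 3(4) by (cases "last (dl t m)") auto
    have "(U, \<theta>) \<in> set (dl t m)"
      using last_in_set[OF companion_node(1)[OF m(1)]] \<theta> by simp
    moreover from this have "(U, \<theta>) \<in> set (dl t n)"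
      unfolding 3(5) by simp
    ultimately have map: "map_of (dl t n) U = Some \<theta>" "map_of (dl t m) U = Some \<theta>"
      using distinct_node[OF v(1)] distinct_node[OF v(2)] map_of_is_SomeI by metis+
    \<comment> \<open>The rule instance at the companion shows that \<open>U\<close> is defined by a
      fixed point.\<close>
    obtain q ts where inner: "subt t m = Inner q RUn ts"
      using m(1) by (cases "subt t m") (auto simp: companion_def)
    then have "rule_inst T RUn q (map label ts)"
      using partial_tableau_good v(2) unfolding partial_tableau_def by (metis tree.case(2))
    then have "rule_inst T RUn (sts t m, dl t m, fm t m) (map label ts)"
      using label_eq[of m] inner by simp
    then obtain Z \<psi> where fix_form: "\<theta> = PNu Z \<psi> \<or> \<theta> = PMu Z \<psi>"
      using 3(4) map(2) by auto
    have "successful_leaf T V t n"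
    proof (cases "is_mu \<theta>")
      case True
      then have "mu_node m" using \<theta> m(1) by (simp add: mu_node_def)
      then show ?thesis
        using wfP_cm 3(3) True s map(1)
        unfolding successful_leaf_def mu_leaf_def is_mu_def by blast
    next
      case False
      then show ?thesis
        using fix_form s map(1) unfolding successful_leaf_def nu_leaf_def is_mu_def by blast
    qed
    then show ?thesis using s by (auto simp: terminal_def)
  qed
  then show ?thesis
    using partial_tableau_good root by (auto simp: successful_tableau_def tableau_def)
qed

end

end

theorem theorem4:
  fixes T :: "('s, 'a) lts" and V :: "'s valuation" and S :: "'s set" and \<Phi> :: "'a pform"
  assumes "wf_form (to_core \<Phi>)"
    and "S \<subseteq> psem T V \<Phi>"
  shows "\<exists>t. successful_tableau T V t \<and> label t = (S, [], \<Phi>)"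
proof -
  have "is_seq (S, [], \<Phi>)" by (simp add: is_seq_def is_deflist_def ddom_def)
  moreover have "S \<subseteq> ext T V [] \<Phi>" using assms(2) by (auto simp: ext_def holds_def)
  ultimately obtain t where t: "good T V (prefixes_of []) t" "label t = (S, [], \<Phi>)"
    using ex_good assms(1) by blast
  \<comment> \<open>No constant is defined at the root, so \<open>C\<close> starts empty.\<close>
  have "prefixes_of [] = ({} :: 'a deflist set)" by (auto simp: prefixes_of_def)
  then have "successful_tableau T V t"
    using good_successful[of T V t] t by (simp add: dl_def)
  then show ?thesis using t(2) by blast
qed

end
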